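(* Let $H$ be a separable Hilbert space, $x_0\in H$, $(y_n)$ a sequence of $H$-valued random variables and $(a_n)$ a sequence of nonnegative reals, and let $(x_n)$ be the sequence of $H$-valued random variables defined recursively from $x_0$ by \[ x_{n+1}:=x_n-a_ny_n . \] Let $z\in H$ and suppose that $L>0$ satisfies $\lVert x_0-z\rVert^2<L$. Define $\mathcal{F}_n:=\sigma(x_0,y_0,\dots,x_{n-1},y_{n-1})$, i.e. $\mathcal{F}_n$ is the $\sigma$-algebra generated by $x_0,y_0,\dots,x_{n-1},y_{n-1}$, and suppose that the following conditions are satisfied: (i) there exist $c,d>0$ and a sequence of nonnegative random variables $(d_n)$ satisfying $\sup_{n\in\mathbb{N}}\mathbb{E}[d_n]\leq d$ such that \[ \mathbb{E}[\lVert y_n\rVert^2\mid\mathcal{F}_n]\leq c\lVert x_n-z\rVert^2+d_n\quad\text{a.s.} \] for all $n\in\mathbb{N}$; (ii) $\langle x_n-z,\mathbb{E}[y_n\mid\mathcal{F}_n]\rangle \geq 0$ a.s. for all $n\in\mathbb{N}$; (iii) there exists a function $\tau:(0,\infty)\to (0,\infty)$ such that \[ \mathbb{E}[\langle x_n-z,\mathbb{E}[y_n\mid\mathcal{F}_n]\rangle]<\tau(\varepsilon)\to \mathbb{E}[f(\lVert x_n-z\rVert^2)]<\varepsilon \] for all $\varepsilon>0$ and $n\in\mathbb{N}$, where $f$ is an s.i.c.c. function with moduli $\psi$ and $\kappa$; (iv) $\sum_{n=0}^\infty a_n=\infty$ with rate of divergence $\theta:\mathbb{N}\times(0,\infty)\to\mathbb{N}$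 and $\sum_{n=0}^\infty a_n^2<M$ with rate of convergence $\chi:(0,\infty)\to\mathbb{N}$, i.e. $\sum_{n=k}^{\theta(k,b)}a_n\geq b$ and $\sum_{n=\chi(\varepsilon)}^\infty a_n^2< \varepsilon$ for any $\varepsilon,b>0$ and any $k\in\mathbb{N}$. Then $\mathbb{E}[f(\lVert x_n-z\rVert^2)]\to 0$ with rate \[ \rho(\varepsilon):=\theta\left(\chi\left(\frac{\kappa\left(K_1\varepsilon\right)}{d}\right),\frac{K_2}{\tau(K_1\varepsilon)}\right) \] for $K_1:=\frac{1}{2}\psi\left(e^{-cM}\right)$ and $K_2:=e^{cM}(L+dM)$, and $x_n\to z$ a.s. with rate $\rho'(\lambda,\varepsilon):=\rho(\lambda f(\varepsilon^2))$.
   Context: All random variables live on a fixed probability space $(\Omega,\mathcal{F},\mathbb{P})$; (in-)equalities between random variables are understood almost surely. Conditional expectations of $H$-valued random variables are understood in the usual (Bochner) sense. A function $f:[0,\infty)\to[0,\infty)$ is called s.i.c.c. with moduli $\psi:[0,1]\to[0,1]$ and $\kappa:(0,\infty)\to(0,\infty)$ if: (1) $f$ is $\psi$-supermultiplicative, i.e. $f(xa)\ge f(x)\psi(a)$ for all $x\in[0,\infty)$ and $a\in[0,1]$, where $\psi(x)>0$ for $x>0$; (2) $f$ is strictly increasing; (3) $f$ is concave; (4) $f$ is continuous with $f(0)=0$, and $\kappa$ is a modulus of continuity at $0$, i.e. $x<\kappa(\varepsilon)$ implies $f(x)<\varepsilon$ for all $x\in[0,\infty)$ and $\varepsilon>0$.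 Rates: "$\mathbb{E}[Y_n]\to0$ with rate $\rho$" (for nonnegative $Y_n$) means $\forall\varepsilon>0\ \forall n\ge\rho(\varepsilon)\ (\mathbb{E}[Y_n]<\varepsilon)$. "$x_n\to z$ a.s. with rate $\rho'$" means $\forall\lambda,\varepsilon>0\ \left(\mathbb{P}(\exists n\ge\rho'(\lambda,\varepsilon)\ (\lVert x_n-z\rVert\ge\varepsilon))<\lambda\right)$. *)

theory Defs
  imports "HOL-Probability.Probability"
begin

text \<open>Functions on \<open>[0,\<infinity>)\<close>, \<open>[0,1]\<close> and \<open>(0,\<infinity>)\<close> are total functions on the reals whose values outside
  these sets are irrelevant.\<close>

definition supermultiplicative :: "(real \<Rightarrow> real) \<Rightarrow> (real \<Rightarrow> real) \<Rightarrow> bool" where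
  "supermultiplicative \<psi> f \<longleftrightarrow>
     (\<forall>a\<in>{0..1}. \<psi> a \<in> {0..1}) \<and> (\<forall>a\<in>{0<..1}. 0 < \<psi> a) \<and>
     (\<forall>x\<ge>0. \<forall>a\<in>{0..1}. f x * \<psi> a \<le> f (x * a))"

definition modulus_at_0 :: "(real \<Rightarrow> real) \<Rightarrow> (real \<Rightarrow> real) \<Rightarrow> bool" where
  "modulus_at_0 \<kappa> f \<longleftrightarrow>
     (\<forall>\<epsilon>>0. 0 < \<kappa> \<epsilon>) \<and> (\<forall>\<epsilon>>0. \<forall>x\<ge>0. x < \<kappa> \<epsilon> \<longrightarrow> f x < \<epsilon>)"

definition sicc :: "(real \<Rightarrow> real) \<Rightarrow> (real \<Rightarrow> real) \<Rightarrow> (real \<Rightarrow> real) \<Rightarrow> bool" where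
  "sicc f \<psi> \<kappa> \<longleftrightarrow>
     (\<forall>x\<ge>0. 0 \<le> f x) \<and> supermultiplicative \<psi> f \<and> strict_mono_on {0..} f \<and>
     concave_on {0..} f \<and> continuous_on {0..} f \<and> f 0 = 0 \<and> modulus_at_0 \<kappa> f"

text \<open>Conditional expectation of Banach-space valued random variables; the distribution's
  \<open>real_cond_exp\<close> and \<open>nn_cond_exp\<close> cover only real and extended nonnegative values. The function
  \<open>cond_exp\<close> picks one version and is unspecified if none exists, in particular if \<open>f\<close> is not
  integrable.\<close>

definition is_cond_exp ::
    "'w measure \<Rightarrow> 'w measure \<Rightarrow> ('w \<Rightarrow> 'h) \<Rightarrow> ('w \<Rightarrow> 'h::{banach, second_countable_topology}) \<Rightarrow> bool" where
  "is_cond_exp P F f g \<longleftrightarrow>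
     integrable P f \<and> integrable P g \<and> g \<in> borel_measurable F \<and>
     (\<forall>A\<in>sets F. (LINT \<omega>:A|P. g \<omega>) = (LINT \<omega>:A|P. f \<omega>))"

definition cond_exp ::
    "'w measure \<Rightarrow> 'w measure \<Rightarrow> ('w \<Rightarrow> 'h) \<Rightarrow> ('w \<Rightarrow> 'h::{banach, second_countable_topology})" where
  "cond_exp P F f = (SOME g. is_cond_exp P F f g)"

definition history ::
    "'w measure \<Rightarrow> (nat \<Rightarrow> 'w \<Rightarrow> 'h::topological_space) \<Rightarrow> (nat \<Rightarrow> 'w \<Rightarrow> 'h) \<Rightarrow> nat \<Rightarrow> 'w measure" where
  "history P x y n = sigma (space P)
     (\<Union>i<n. {x i -` A \<inter> space P |A. A \<in> sets borel} \<union> {y i -` A \<inter> space P |A. A \<in> sets borel})"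

definition divergence_rate :: "(nat \<Rightarrow> real) \<Rightarrow> (nat \<Rightarrow> real \<Rightarrow> nat) \<Rightarrow> bool" where
  "divergence_rate a \<theta> \<longleftrightarrow> (\<forall>k. \<forall>b>0. b \<le> (\<Sum>n = k..\<theta> k b. a n))"

definition series_convergence_rate :: "(nat \<Rightarrow> real) \<Rightarrow> (real \<Rightarrow> nat) \<Rightarrow> bool" where
  "series_convergence_rate s r \<longleftrightarrow> summable s \<and> (\<forall>\<epsilon>>0. (\<Sum>n. s (n + r \<epsilon>)) < \<epsilon>)"

text \<open>Integrability is part of the next notion because the Bochner integral of a nonintegrable
  function is 0 by convention.\<close>

definition mean_rate :: "'w measure \<Rightarrow> (nat \<Rightarrow> 'w \<Rightarrow> real) \<Rightarrow> (real \<Rightarrow> nat) \<Rightarrow> bool" where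
  "mean_rate P Y \<rho> \<longleftrightarrow>
     (\<forall>\<epsilon>>0. \<forall>n\<ge>\<rho> \<epsilon>. integrable P (Y n) \<and> (LINT \<omega>|P. Y n \<omega>) < \<epsilon>)"

definition as_rate ::
    "'w measure \<Rightarrow> (nat \<Rightarrow> 'w \<Rightarrow> 'h::real_normed_vector) \<Rightarrow> 'h \<Rightarrow> (real \<Rightarrow> real \<Rightarrow> nat) \<Rightarrow> bool" where
  "as_rate P x z \<rho>' \<longleftrightarrow>
     (\<forall>\<delta>>0. \<forall>\<epsilon>>0. measure P {\<omega>\<in>space P. \<exists>n\<ge>\<rho>' \<delta> \<epsilon>. \<epsilon> \<le> norm (x n \<omega> - z)} < \<delta>)"

end

theory Submission
  imports Defs
begin

text \<open>Put \<open>V n = (norm (x n - z))\<^sup>2\<close>. Expanding the square and conditioning on the history gives, on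
  every event of the history, \<open>E V (n + 1) + 2 a\<^sub>n E \<langle>x\<^sub>n - z, E[y\<^sub>n | F\<^sub>n]\<rangle> \<le> (1 + c a\<^sub>n\<^sup>2) E V n + a\<^sub>n\<^sup>2 E D n\<close>.
  By Gronwall's inequality the sum of the weighted inner products is less than \<open>K2\<close>, so the divergence
  rate yields an index \<open>n\<close> below the claimed rate, beyond \<open>chi\<close>, at which the mean inner product is
  below \<open>\<tau>\<close>, hence \<open>E f (V n)\<close> is small. From this \<open>n\<close> onwards let \<open>X\<^sub>k\<close> be \<open>V (n + k)\<close> stopped on
  entering a set \<open>Q\<close>. Then \<open>E[exp (- c M) X\<^sub>k | F\<^sub>n] \<le> V n + S\<close> with \<open>E S\<close> at most \<open>d\<close> times the tail of
  \<open>\<Sum> a\<^sub>i\<^sup>2\<close>, and conditional Jensen and subadditivity of \<open>f\<close> bound \<open>E f (exp (- c M) X\<^sub>k)\<close>. The choice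
  \<open>Q = {}\<close> gives the rate in mean, \<open>Q = {\<epsilon>\<^sup>2..}\<close> the almost sure rate.\<close>

subsection \<open>Conditional expectation in Hilbert spaces\<close>

context finite_measure_subalgebra begin

text \<open>The identity is linear in \<open>u\<close>, and for \<open>u\<close> constant on a set
  of \<open>F\<close> and zero elsewhere it is the defining property of a conditional expectation.
  Simple functions measurable in \<open>F\<close> approximate \<open>u\<close>, and the bound
  \<open>C\<close> permits dominated convergence.\<close>

lemma integral_inner_cond_exp_bounded:
  fixes f g u :: "'a \<Rightarrow> 'h::{real_inner, banach, second_countable_topology}"
  assumes g: "is_cond_exp M F f g" and u[measurable]: "u \<in> borel_measurable F"
    and bound: "\<And>x. norm (u x) \<le> C"
  shows "(LINT x|M. inner (u x) (g x)) = (LINT x|M. inner (u x) (f x))"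
proof -
  have [measurable]: "u \<in> borel_measurable M" and [simp]: "space F = space M"
    using measurable_from_subalg[OF subalg u] subalg by (auto simp: subalgebra_def)
  have int: "integrable M f" "integrable M g"
    and eq: "\<And>A. A \<in> sets F \<Longrightarrow> (LINT x:A|M. g x) = (LINT x:A|M. f x)"
    using g by (auto simp: is_cond_exp_def)
  obtain s where "\<forall>i. simple_function F (s i)"
      "\<forall>x\<in>space F. (\<lambda>i. s i x) \<longlonglongrightarrow> u x"
      "\<forall>i. \<forall>x\<in>space F. dist (s i x) 0 \<le> 2 * dist (u x) 0"
    using borel_measurable_implies_sequence_metric[OF u] by blast
  then have s: "\<And>i. simple_function F (s i)"
      "\<And>x. x \<in> space M \<Longrightarrow> (\<lambda>i. s i x) \<longlonglongrightarrow> u x"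
      "\<And>i x. x \<in> space M \<Longrightarrow> norm (s i x) \<le> 2 * norm (u x)"
    by simp_all
  have sM[measurable]: "s i \<in> borel_measurable M" for i
    using measurable_from_subalg[OF subalg borel_measurable_simple_function[OF s(1)]] .
  \<comment> \<open>Only integrals of \<open>h\<close> over level sets of \<open>s i\<close> remain.
    These sets lie in \<open>F\<close>, where \<open>f\<close> and \<open>g\<close> have equal
    integrals.\<close>
  have simple: "(LINT x|M. inner (s i x) (h x)) =
      (\<Sum>v\<in>s i ` space M. inner v (LINT x:(s i -` {v} \<inter> space M)|M. h x))"
    if h: "integrable M h" for h i
  proof -
    have F: "s i -` {v} \<inter> space M \<in> sets F" for v
      using simple_functionD(2)[OF s(1), of i "{v}"] by simp
    have M: "s i -` {v} \<inter> space M \<in> sets M" for v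
      using F subalg by (auto simp: subalgebra_def)
    have "(LINT x|M. inner (s i x) (h x)) = (LINT x|M. (\<Sum>v\<in>s i ` space M.
        inner v (indicator (s i -` {v} \<inter> space M) x *\<^sub>R h x)))"
    proof (rule Bochner_Integration.integral_cong[OF refl])
      fix x assume x: "x \<in> space M"
      have "inner (s i x) (h x) = inner (\<Sum>v\<in>s i ` space M.
          indicator (s i -` {v} \<inter> space M) x *\<^sub>R v) (h x)"
        by (rule arg_cong[of _ _ "\<lambda>v. inner v (h x)"],
            rule simple_function_indicator_representation_banach[OF s(1),
              unfolded \<open>space F = space M\<close>, OF x])
      then show "inner (s i x) (h x) = (\<Sum>v\<in>s i ` space M.
          inner v (indicator (s i -` {v} \<inter> space M) x *\<^sub>R h x))"
        by (simp add: inner_sum_left)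
    qed
    also have "\<dots> = (\<Sum>v\<in>s i ` space M.
        LINT x|M. inner v (indicator (s i -` {v} \<inter> space M) x *\<^sub>R h x))"
      by (intro Bochner_Integration.integral_sum integrable_inner_right integrable_mult_indicator M h)
    finally show ?thesis
      unfolding set_lebesgue_integral_def
      by (simp only: integral_inner_right[OF integrable_mult_indicator[OF M h]])
  qed
  have "(\<lambda>i. LINT x|M. inner (s i x) (h x)) \<longlonglongrightarrow> (LINT x|M. inner (u x) (h x))"
    if h: "integrable M h" for h
  proof (rule integral_dominated_convergence[where w="\<lambda>x. 2 * C * norm (h x)"])
    show "(\<lambda>x. inner (u x) (h x)) \<in> borel_measurable M"
      "\<And>i. (\<lambda>x. inner (s i x) (h x)) \<in> borel_measurable M"
      using h by (auto intro!: borel_measurable_inner)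
    show "integrable M (\<lambda>x. 2 * C * norm (h x))"
      using h by simp
    show "AE x in M. (\<lambda>i. inner (s i x) (h x)) \<longlonglongrightarrow> inner (u x) (h x)"
      using s(2) by (auto intro!: tendsto_intros)
    show "AE x in M. norm (inner (s i x) (h x)) \<le> 2 * C * norm (h x)" for i
    proof (rule AE_I2)
      fix x assume "x \<in> space M"
      then have "norm (s i x) \<le> 2 * C"
        using s(3)[of x i] bound[of x] by linarith
      then have "norm (s i x) * norm (h x) \<le> 2 * C * norm (h x)"
        by (intro mult_right_mono) auto
      then show "norm (inner (s i x) (h x)) \<le> 2 * C * norm (h x)"
        using Cauchy_Schwarz_ineq2[of "s i x" "h x"] by simp
    qed
  qed
  note lim = this
  have "(LINT x|M. inner (s i x) (g x)) = (LINT x|M. inner (s i x) (f x))" for i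
    unfolding simple[OF int(1)] simple[OF int(2)]
    using simple_functionD(2)[OF s(1)[of i]] by (intro sum.cong refl) (simp add: eq)
  with lim[OF int(1)] lim[OF int(2)] show ?thesis
    by (simp add: LIMSEQ_unique)
qed

text \<open>Testing \<open>g\<close> against its own direction \<open>sgn (g x)\<close>, which is
  measurable in \<open>F\<close> and of norm at most 1, turns \<open>norm (g x)\<close> into an
  inner product in which \<open>g\<close> may be replaced by \<open>f\<close>.\<close>

lemma is_cond_exp_norm_le:
  fixes f g :: "'a \<Rightarrow> 'h::{real_inner, banach, second_countable_topology}"
  assumes g: "is_cond_exp M F f g"
  shows "(LINT x|M. norm (g x)) \<le> (LINT x|M. norm (f x))"
proof -
  have int: "integrable M f" "integrable M g" and gF[measurable]: "g \<in> borel_measurable F"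
    using g by (auto simp: is_cond_exp_def)
  have [measurable]: "f \<in> borel_measurable M" "g \<in> borel_measurable M"
    using int by auto
  have "(\<lambda>x. sgn (g x)) \<in> borel_measurable F"
    unfolding sgn_div_norm by measurable
  then have "(LINT x|M. inner (sgn (g x)) (g x)) = (LINT x|M. inner (sgn (g x)) (f x))"
    by (intro integral_inner_cond_exp_bounded[OF g, where C=1]) (auto simp: norm_sgn)
  moreover have "inner (sgn (g x)) (g x) = norm (g x)" for x
    by (cases "g x = 0") (simp_all add: sgn_div_norm dot_square_norm power2_eq_square)
  moreover have "(LINT x|M. inner (sgn (g x)) (f x)) \<le> (LINT x|M. norm (f x))"
  proof (rule integral_mono_AE')
    show "integrable M (\<lambda>x. norm (f x))" using int by simp
    show "AE x in M. inner (sgn (g x)) (f x) \<le> norm (f x)"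
    proof (rule AE_I2)
      fix x
      have "inner (sgn (g x)) (f x) \<le> norm (sgn (g x)) * norm (f x)"
        by (rule norm_cauchy_schwarz)
      also have "\<dots> \<le> norm (f x)" by (simp add: norm_sgn)
      finally show "inner (sgn (g x)) (f x) \<le> norm (f x)" .
    qed
  qed auto
  ultimately show ?thesis by simp
qed

lemma is_cond_exp_add:
  fixes f g f' g' :: "'a \<Rightarrow> 'h::{banach, second_countable_topology}"
  assumes "is_cond_exp M F f g" "is_cond_exp M F f' g'"
  shows "is_cond_exp M F (\<lambda>x. f x + f' x) (\<lambda>x. g x + g' x)"
proof -
  have "A \<in> sets M" if "A \<in> sets F" for A
    using that subalg by (auto simp: subalgebra_def)
  then show ?thesis
    using assms
    by (auto simp: is_cond_exp_def set_lebesgue_integral_def scaleR_add_right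
        Bochner_Integration.integral_add[OF integrable_mult_indicator integrable_mult_indicator])
qed

lemma is_cond_exp_diff:
  fixes f g f' g' :: "'a \<Rightarrow> 'h::{banach, second_countable_topology}"
  assumes "is_cond_exp M F f g" "is_cond_exp M F f' g'"
  shows "is_cond_exp M F (\<lambda>x. f x - f' x) (\<lambda>x. g x - g' x)"
proof -
  have "A \<in> sets M" if "A \<in> sets F" for A
    using that subalg by (auto simp: subalgebra_def)
  then show ?thesis
    using assms
    by (auto simp: is_cond_exp_def set_lebesgue_integral_def scaleR_diff_right
        Bochner_Integration.integral_diff[OF integrable_mult_indicator integrable_mult_indicator])
qed

text \<open>The norm inequality for conditional expectations passes summability in mean from
  \<open>f\<close> to \<open>g\<close>, so the series of versions converges almost everywhere and
  may be integrated term by term. The link between \<open>f\<close> and \<open>S\<close> is stated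
  through set integrals because a telescoping series delivers it in that form.\<close>

lemma is_cond_exp_suminf:
  fixes f g :: "nat \<Rightarrow> 'a \<Rightarrow> 'h::{real_inner, banach, second_countable_topology}"
  assumes ce: "\<And>i. is_cond_exp M F (f i) (g i)"
    and int_S: "integrable M S"
    and sums: "\<And>A. A \<in> sets M \<Longrightarrow> (\<lambda>i. LINT x:A|M. f i x) sums (LINT x:A|M. S x)"
    and summable: "summable (\<lambda>i. LINT x|M. norm (f i x))"
  shows "is_cond_exp M F S (\<lambda>x. \<Sum>i. g i x)"
proof -
  have int: "\<And>i. integrable M (f i)" "\<And>i. integrable M (g i)"
    and [measurable]: "\<And>i. g i \<in> borel_measurable F"
    and eq: "\<And>i A. A \<in> sets F \<Longrightarrow> (LINT x:A|M. g i x) = (LINT x:A|M. f i x)"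
    using ce by (auto simp: is_cond_exp_def)
  have [measurable]: "\<And>i. g i \<in> borel_measurable M"
    using int by auto
  have sum_norm: "summable (\<lambda>i. LINT x|M. norm (g i x))"
    by (rule summable_comparison_test[OF _ summable])
       (use is_cond_exp_norm_le[OF ce] in \<open>auto intro!: exI[of _ 0] simp: integral_nonneg_AE\<close>)
  have ae: "AE x in M. summable (\<lambda>i. norm (g i x))"
  proof -
    have "(\<integral>\<^sup>+x. (\<Sum>i. ennreal (norm (g i x))) \<partial>M) = (\<Sum>i. \<integral>\<^sup>+x. ennreal (norm (g i x)) \<partial>M)"
      by (intro nn_integral_suminf) auto
    also have "\<dots> = (\<Sum>i. ennreal (LINT x|M. norm (g i x)))"
      by (intro suminf_cong nn_integral_eq_integral) (auto simp: int)
    also have "\<dots> = ennreal (\<Sum>i. LINT x|M. norm (g i x))"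
      using sum_norm by (intro suminf_ennreal2) (auto simp: integral_nonneg_AE)
    finally have "(\<integral>\<^sup>+x. (\<Sum>i. ennreal (norm (g i x))) \<partial>M) \<noteq> \<infinity>"
      by simp
    then have "AE x in M. (\<Sum>i. ennreal (norm (g i x))) \<noteq> \<infinity>"
      by (intro nn_integral_PInf_AE) auto
    then show ?thesis
      by eventually_elim (auto intro!: summable_suminf_not_top)
  qed
  have int_sum: "integrable M (\<lambda>x. \<Sum>i. g i x)"
    by (rule integrable_suminf[OF int(2) ae sum_norm])
  have "(LINT x:A|M. (\<Sum>i. g i x)) = (LINT x:A|M. S x)" if A: "A \<in> sets F" for A
  proof -
    have AM: "A \<in> sets M" using A subalg by (auto simp: subalgebra_def)
    have "(\<lambda>i. LINT x|M. indicator A x *\<^sub>R g i x) sums (LINT x|M. (\<Sum>i. indicator A x *\<^sub>R g i x))"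
    proof (rule sums_integral)
      show "integrable M (\<lambda>x. indicator A x *\<^sub>R g i x)" for i
        by (rule integrable_mult_indicator[OF AM int(2)])
      show "AE x in M. summable (\<lambda>i. norm (indicator A x *\<^sub>R g i x))"
        using ae by eventually_elim (auto simp: indicator_def)
      have "(LINT x|M. norm (indicator A x *\<^sub>R g i x)) \<le> (LINT x|M. norm (g i x))" for i
        using int by (intro integral_mono integrable_norm integrable_mult_indicator[OF AM])
          (auto simp: indicator_def)
      then show "summable (\<lambda>i. LINT x|M. norm (indicator A x *\<^sub>R g i x))"
        by (intro summable_comparison_test[OF _ sum_norm])
           (auto intro!: exI[of _ 0] simp: integral_nonneg_AE)
    qed
    also have "(LINT x|M. (\<Sum>i. indicator A x *\<^sub>R g i x)) = (LINT x:A|M. (\<Sum>i. g i x))"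
      unfolding set_lebesgue_integral_def
      by (intro Bochner_Integration.integral_cong) (auto simp: indicator_def)
    finally have "(\<lambda>i. LINT x:A|M. f i x) sums (LINT x:A|M. (\<Sum>i. g i x))"
      using eq[OF A] by (simp add: set_lebesgue_integral_def)
    from sums_unique2[OF this sums[OF AM]] show ?thesis .
  qed
  with int_S int_sum show ?thesis
    by (auto simp: is_cond_exp_def)
qed

text \<open>Scaled indicators reduce to the real case and sums to additivity. A limit is reached
  along a rapidly converging subsequence, whose telescoping series can be conditioned term by
  term.\<close>

lemma is_cond_exp_exists:
  fixes f :: "'a \<Rightarrow> 'h::{real_inner, banach, second_countable_topology}"
  assumes "integrable M f"
  shows "\<exists>g. is_cond_exp M F f g"
  using assms
proof (induction f rule: integrable_induct)
  case (base A c)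
  let ?g = "real_cond_exp M F (indicator A)"
  have int: "integrable M (indicator A :: 'a \<Rightarrow> real)"
    using base by (simp add: integrable_indicator_iff)
  have "is_cond_exp M F (\<lambda>x. indicator A x *\<^sub>R c) (\<lambda>x. ?g x *\<^sub>R c)"
    unfolding is_cond_exp_def
  proof (intro conjI ballI)
    fix B assume B: "B \<in> sets F"
    then have BM: "B \<in> sets M" using subalg by (auto simp: subalgebra_def)
    have eq: "(LINT x:B|M. h x *\<^sub>R c) = (LINT x:B|M. h x) *\<^sub>R c"
      if "integrable M h" for h :: "'a \<Rightarrow> real"
      using integral_scaleR_left[OF integrable_mult_indicator[OF BM that], of c]
      by (simp add: set_lebesgue_integral_def)
    show "(LINT x:B|M. ?g x *\<^sub>R c) = (LINT x:B|M. indicator A x *\<^sub>R c)"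
      using real_cond_exp_intA[OF int B] by (simp add: eq int real_cond_exp_int(1)[OF int])
  qed (use int real_cond_exp_int(1)[OF int] in \<open>auto intro!: borel_measurable_scaleR\<close>)
  then show ?case by blast
next
  case (add f g)
  then show ?case using is_cond_exp_add by blast
next
  case (lim f s)
  have int_s: "integrable M (s i)" for i using lim by blast
  have int_f: "integrable M f" using lim by blast
  have [measurable]: "f \<in> borel_measurable M" "\<And>i. s i \<in> borel_measurable M"
    using int_s int_f by auto
  have "(\<lambda>i. LINT x|M. norm (s i x - f x)) \<longlonglongrightarrow> (LINT x|M. 0)"
  proof (rule integral_dominated_convergence[where w="\<lambda>x. 3 * norm (f x)"])
    show "AE x in M. (\<lambda>i. norm (s i x - f x)) \<longlonglongrightarrow> 0"
    proof (rule AE_I2)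
      fix x assume "x \<in> space M"
      then have "(\<lambda>i. s i x) \<longlonglongrightarrow> f x" using lim by blast
      then show "(\<lambda>i. norm (s i x - f x)) \<longlonglongrightarrow> 0"
        by (intro tendsto_norm_zero LIM_zero)
    qed
    show "AE x in M. norm (norm (s i x - f x)) \<le> 3 * norm (f x)" for i
    proof (rule AE_I2)
      fix x assume "x \<in> space M"
      then have "norm (s i x) \<le> 2 * norm (f x)" using lim by blast
      then show "norm (norm (s i x - f x)) \<le> 3 * norm (f x)"
        using norm_triangle_ineq4[of "s i x" "f x"] by simp
    qed
  qed (use int_s int_f in auto)
  then have L1: "(\<lambda>i. LINT x|M. norm (s i x - f x)) \<longlonglongrightarrow> 0" by simp
  \<comment> \<open>Geometric errors in mean make the successive differences along the subsequence
    summable in mean.\<close>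
  have "\<exists>i. (LINT x|M. norm (s i x - f x)) < (1/2)^n" for n
  proof -
    have "eventually (\<lambda>i. (LINT x|M. norm (s i x - f x)) < (1/2)^n) sequentially"
      using order_tendstoD(2)[OF L1, of "(1/2)^n"] by simp
    then show ?thesis by (auto simp: eventually_sequentially)
  qed
  then obtain r where r: "\<And>n. (LINT x|M. norm (s (r n) x - f x)) < (1/2)^n" by metis
  \<comment> \<open>Starting from 0 makes the telescoping series sum to \<open>f\<close> itself,
    without an initial term.\<close>
  define t where "t n = (if n = 0 then (\<lambda>x. 0) else s (r n))" for n
  obtain g where g: "\<And>i. is_cond_exp M F (s i) (g i)"
    using lim.IH by metis
  define h where "h n = (if n = 0 then (\<lambda>x. 0) else g (r n))" for n
  have tri: "norm (p - q) \<le> norm (p - e) + norm (q - e)" for p q e :: 'h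
    using norm_triangle_ineq4[of "p - e" "q - e"] by simp
  have zero: "is_cond_exp M F (\<lambda>x. 0) (\<lambda>x. 0::'h)"
    by (auto simp: is_cond_exp_def)
  have th: "is_cond_exp M F (t n) (h n)" for n
    using g zero by (simp add: t_def h_def)
  have int_t: "integrable M (t n)" for n
    using th by (auto simp: is_cond_exp_def)
  have t_bound: "(LINT x|M. norm (t (Suc n) x - f x)) \<le> (1/2)^Suc n" for n
    using r[of "Suc n"] by (simp add: t_def)
  have "is_cond_exp M F f (\<lambda>x. \<Sum>i. h (Suc i) x - h i x)"
  proof (rule is_cond_exp_suminf)
    show "is_cond_exp M F (\<lambda>x. t (Suc i) x - t i x) (\<lambda>x. h (Suc i) x - h i x)" for i
      by (rule is_cond_exp_diff[OF th th])
    show "integrable M f" by fact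
    fix A assume A: "A \<in> sets M"
    have "(\<lambda>i. LINT x:A|M. t (Suc i) x) \<longlonglongrightarrow> (LINT x:A|M. f x)"
    proof (rule tendsto_norm_zero_cancel[THEN LIM_zero_cancel], 
           rule tendsto_sandwich[OF _ _ tendsto_const])
      show "\<forall>\<^sub>F i in sequentially. norm ((LINT x:A|M. t (Suc i) x) - (LINT x:A|M. f x)) \<le> (1/2)^Suc i"
      proof (rule always_eventually, rule allI)
        fix i
        have "(LINT x:A|M. t (Suc i) x) - (LINT x:A|M. f x) = (LINT x|M. indicator A x *\<^sub>R (t (Suc i) x - f x))"
          unfolding set_lebesgue_integral_def scaleR_diff_right
          by (rule Bochner_Integration.integral_diff[symmetric])
             (intro integrable_mult_indicator A int_t int_f)+
        also have "norm \<dots> \<le> (LINT x|M. norm (indicator A x *\<^sub>R (t (Suc i) x - f x)))"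
          by (rule integral_norm_bound)
        also have "\<dots> \<le> (LINT x|M. norm (t (Suc i) x - f x))"
          using int_t int_f by (intro integral_mono integrable_norm integrable_mult_indicator[OF A])
            (auto simp: indicator_def)
        also note t_bound
        finally show "norm ((LINT x:A|M. t (Suc i) x) - (LINT x:A|M. f x)) \<le> (1/2)^Suc i" .
      qed
      show "(\<lambda>i. (1/2::real) ^ Suc i) \<longlonglongrightarrow> 0"
        by (intro LIMSEQ_Suc LIMSEQ_realpow_zero) auto
    qed auto
    then have "(\<lambda>i. (LINT x:A|M. t i x)) \<longlonglongrightarrow> (LINT x:A|M. f x)"
      by (rule LIMSEQ_imp_Suc)
    from telescope_sums[OF this]
    have "(\<lambda>i. (LINT x:A|M. t (Suc i) x) - (LINT x:A|M. t i x)) sums (LINT x:A|M. f x)"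
      by (simp add: t_def set_lebesgue_integral_def)
    moreover have "(LINT x:A|M. t (Suc i) x) - (LINT x:A|M. t i x) = (LINT x:A|M. t (Suc i) x - t i x)" for i
      unfolding set_lebesgue_integral_def scaleR_diff_right
      by (rule Bochner_Integration.integral_diff[symmetric])
         (intro integrable_mult_indicator A int_t)+
    ultimately show "(\<lambda>i. LINT x:A|M. t (Suc i) x - t i x) sums (LINT x:A|M. f x)"
      by simp
  next
    \<comment> \<open>The first difference starts from the artificial value 0 and has no such bound,
      so summability is shown for the shifted sequence.\<close>
    have "(LINT x|M. norm (t (Suc (Suc n)) x - t (Suc n) x)) \<le> (1/2)^n" for n
    proof -
      have "(LINT x|M. norm (t (Suc (Suc n)) x - t (Suc n) x)) 
          \<le> (LINT x|M. norm (t (Suc (Suc n)) x - f x) + norm (t (Suc n) x - f x))"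
        using int_t int_f tri by (intro integral_mono) auto
      also have "\<dots> = (LINT x|M. norm (t (Suc (Suc n)) x - f x)) + (LINT x|M. norm (t (Suc n) x - f x))"
        using int_t int_f by (intro Bochner_Integration.integral_add) auto
      also have "\<dots> \<le> (1/2)^Suc (Suc n) + (1/2)^Suc n"
        using t_bound by (intro add_mono)
      also have "\<dots> \<le> (1/2)^n" by simp
      finally show ?thesis .
    qed
    then have "summable (\<lambda>n. LINT x|M. norm (t (Suc (Suc n)) x - t (Suc n) x))"
      by (intro summable_comparison_test[OF _ summable_geometric[of "1/2::real"]])
         (auto intro!: exI[of _ 0] simp: integral_nonneg_AE)
    then show "summable (\<lambda>n. LINT x|M. norm (t (Suc n) x - t n x))"
      by (subst summable_Suc_iff[symmetric])
  qed
  then show ?case by blast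
qed

text \<open>For unbounded \<open>u\<close> the product with \<open>g\<close> is not known to be
  integrable in advance. The sign condition makes the truncated products increase, so monotone
  convergence yields integrability and the equality together.\<close>

lemma integral_inner_cond_exp_nonneg:
  fixes f g u :: "'a \<Rightarrow> 'h::{real_inner, banach, second_countable_topology}"
  assumes g: "is_cond_exp M F f g" and u[measurable]: "u \<in> borel_measurable F"
    and int: "integrable M (\<lambda>x. inner (u x) (f x))"
    and nonneg: "AE x in M. 0 \<le> inner (u x) (g x)"
  shows "integrable M (\<lambda>x. inner (u x) (g x))"
    and "(LINT x|M. inner (u x) (g x)) = (LINT x|M. inner (u x) (f x))"
proof -
  \<comment> \<open>The truncation keeps \<open>u x\<close> or drops it, without rescaling. Each
    product is therefore 0 or its full value, and increases in \<open>k\<close> wherever the full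
    value is nonnegative.\<close>
  define v where "v k x = (if norm (u x) \<le> real k then u x else 0)" for k x
  have [measurable]: "v k \<in> borel_measurable F" for k
    unfolding v_def by measurable
  have vM[measurable]: "v k \<in> borel_measurable M" for k
    by (rule measurable_from_subalg[OF subalg]) measurable
  have uM[measurable]: "u \<in> borel_measurable M"
    by (rule measurable_from_subalg[OF subalg u])
  have [measurable]: "f \<in> borel_measurable M" "g \<in> borel_measurable M"
    and int_g: "integrable M g"
    using g by (auto simp: is_cond_exp_def)
  have v_bound: "norm (v k x) \<le> real k" for k x
    by (simp add: v_def)
  have v_lim: "(\<lambda>k. inner (v k x) (h x)) \<longlonglongrightarrow> inner (u x) (h x)" for x and h :: "'a \<Rightarrow> 'h"
  proof (rule tendsto_eventually)
    obtain N where "norm (u x) \<le> real N" using real_arch_simple by blast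
    then show "\<forall>\<^sub>F k in sequentially. inner (v k x) (h x) = inner (u x) (h x)"
      by (intro eventually_sequentiallyI[of N]) (auto simp: v_def)
  qed
  have eq: "(LINT x|M. inner (v k x) (g x)) = (LINT x|M. inner (v k x) (f x))" for k
    by (rule integral_inner_cond_exp_bounded[OF g _ v_bound]) measurable
  \<comment> \<open>By \<open>eq\<close> this is also the limit of the integrals on the side of
    \<open>g\<close>, as monotone convergence requires.\<close>
  have lim: "(\<lambda>k. LINT x|M. inner (v k x) (f x)) \<longlonglongrightarrow> (LINT x|M. inner (u x) (f x))"
    by (rule integral_dominated_convergence[where w="\<lambda>x. norm (inner (u x) (f x))"])
       (use int v_lim in \<open>auto simp: v_def\<close>)
  have int_v: "integrable M (\<lambda>x. inner (v k x) (g x))" for k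
  proof (rule Bochner_Integration.integrable_bound[of _ "\<lambda>x. real k * norm (g x)"])
    show "AE x in M. norm (inner (v k x) (g x)) \<le> norm (real k * norm (g x))"
    proof (rule AE_I2)
      fix x
      have "\<bar>inner (v k x) (g x)\<bar> \<le> norm (v k x) * norm (g x)"
        by (rule Cauchy_Schwarz_ineq2)
      also have "\<dots> \<le> real k * norm (g x)"
        by (intro mult_right_mono v_bound) auto
      finally show "norm (inner (v k x) (g x)) \<le> norm (real k * norm (g x))" by simp
    qed
  qed (use int_g in auto)
  have mono: "AE x in M. mono (\<lambda>k. inner (v k x) (g x))"
    using nonneg by eventually_elim (auto simp: mono_def v_def)
  have pos: "AE x in M. 0 \<le> inner (v k x) (g x)" for k
    using nonneg by eventually_elim (auto simp: v_def)
  note * = integral_monotone_convergence_nonneg[OF int_v mono pos _ lim[folded eq],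
      of "\<lambda>x. inner (u x) (g x)"]
  show "integrable M (\<lambda>x. inner (u x) (g x))"
    "(LINT x|M. inner (u x) (g x)) = (LINT x|M. inner (u x) (f x))"
    using * v_lim by auto
qed

end

subsection \<open>Concave functions of almost supermartingales\<close>

text \<open>Since \<open>1 + \<beta> k\<close> is at least 1, the accumulated sum of
  \<open>g\<close> may be multiplied by it as well and travels through the induction next to
  \<open>v\<close>. A bound on the total drift thus comes with the bound on
  \<open>v\<close>.\<close>

lemma discrete_gronwall:
  fixes v g e \<beta> :: "nat \<Rightarrow> real"
  assumes step: "\<And>k. v (Suc k) + g k \<le> (1 + \<beta> k) * v k + e k"
    and nonneg: "\<And>k. 0 \<le> v k" "\<And>k. 0 \<le> g k" "\<And>k. 0 \<le> e k" "\<And>k. 0 \<le> \<beta> k"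
  shows "v k + (\<Sum>i<k. g i) \<le> exp (\<Sum>i<k. \<beta> i) * (v 0 + (\<Sum>i<k. e i))"
proof (induction k)
  case (Suc k)
  have "v (Suc k) + (\<Sum>i<Suc k. g i) \<le> (1 + \<beta> k) * v k + e k + (\<Sum>i<k. g i)"
    using step[of k] by simp
  also have "\<dots> \<le> (1 + \<beta> k) * (v k + (\<Sum>i<k. g i)) + e k"
    using nonneg(4)[of k] sum_nonneg[of "{..<k}" g] nonneg(2) by (simp add: algebra_simps)
  \<comment> \<open>Besides \<open>1 + \<beta> k \<le> exp (\<beta> k)\<close>, the term
    \<open>e k\<close> receives the full exponential, which is at least 1, so that it can be
    factored out.\<close>
  also have "\<dots> \<le> exp (\<beta> k) * (exp (\<Sum>i<k. \<beta> i) * (v 0 + (\<Sum>i<k. e i))) + exp (\<Sum>i<Suc k. \<beta> i) * e k"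
  proof (intro add_mono mult_mono Suc)
    have "1 \<le> exp (\<Sum>i<Suc k. \<beta> i)"
      using nonneg(4) sum_nonneg[of "{..<Suc k}" \<beta>] by simp
    then show "e k \<le> exp (\<Sum>i<Suc k. \<beta> i) * e k"
      using mult_right_mono[OF _ nonneg(3)] by fastforce
  qed (use nonneg in \<open>auto simp: sum_nonneg\<close>)
  also have "\<dots> = exp (\<Sum>i<Suc k. \<beta> i) * (v 0 + (\<Sum>i<Suc k. e i))"
    by (simp add: exp_add algebra_simps)
  finally show ?case .
qed simp

text \<open>The test for step \<open>Suc k\<close> looks at times up to \<open>k\<close> only, so
  the value at the first entry into \<open>Q\<close> is still taken and then kept.\<close>

primrec stopped :: "'b set \<Rightarrow> (nat \<Rightarrow> 'b) \<Rightarrow> nat \<Rightarrow> 'b" where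
  "stopped Q v 0 = v 0"
| "stopped Q v (Suc k) = (if \<exists>j\<le>k. v j \<in> Q then stopped Q v k else v (Suc k))"

lemma stopped_eq:
  assumes "\<And>j. j < k \<Longrightarrow> v j \<notin> Q"
  shows "stopped Q v k = v k"
  using assms by (cases k) auto

lemma stopped_mem:
  assumes "\<exists>j\<le>k. v j \<in> Q"
  shows "stopped Q v k \<in> Q"
  using assms by (induction k) (auto simp: le_Suc_eq)

section \<open>Concave gauges and Jensen's inequality\<close>

locale concave_gauge =
  fixes h :: "real \<Rightarrow> real"
  assumes mono: "mono h" and concave: "concave_on {0..} h" and zero: "h 0 = 0"
begin

lemma measurable_gauge [measurable]: "h \<in> borel_measurable borel"
  by (rule borel_measurable_mono[OF mono])

lemma gauge_nonneg: "0 \<le> x \<Longrightarrow> 0 \<le> h x"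
  using monoD[OF mono, of 0 x] zero by simp

lemma star_shaped:
  assumes "0 \<le> t" "t \<le> 1" "0 \<le> x"
  shows "t * h x \<le> h (t * x)"
  using concave_onD[OF concave, of t 0 x] assms zero by simp

text \<open>Star-shapedness with the weights \<open>x / (x + y)\<close> and
  \<open>y / (x + y)\<close> bounds \<open>h x\<close> and \<open>h y\<close> from below by shares
  of \<open>h (x + y)\<close> that add up to the whole.\<close>

lemma subadditive:
  assumes "0 \<le> x" "0 \<le> y"
  shows "h (x + y) \<le> h x + h y"
proof (cases "x + y = 0")
  case False
  then have pos: "x + y > 0" using assms by simp
  have "x / (x + y) * h (x + y) \<le> h (x / (x + y) * (x + y))"
    "y / (x + y) * h (x + y) \<le> h (y / (x + y) * (x + y))"
    using assms pos by (intro star_shaped; simp)+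
  moreover have "x / (x + y) * h (x + y) + y / (x + y) * h (x + y) = h (x + y)"
    using False by (simp flip: distrib_right add_divide_distrib)
  ultimately show ?thesis using False by simp
next
  case True
  then have "x = 0" "y = 0" using assms by auto
  then show ?thesis using zero by simp
qed

text \<open>Beyond 1, star-shapedness with factor \<open>1 / x\<close> limits the growth to linear.
  Through this bound \<open>h (X x)\<close> inherits integrability from \<open>X\<close>.\<close>

lemma gauge_le_affine:
  assumes "0 \<le> x"
  shows "h x \<le> h 1 * (1 + x)"
proof (cases "x \<le> 1")
  case True
  have "h x \<le> h 1" using monoD[OF mono True] .
  also have "\<dots> \<le> h 1 * (1 + x)" using gauge_nonneg[of 1] assms by (simp add: algebra_simps)
  finally show ?thesis .
next
  case False
  then have "1 / x * h x \<le> h (1 / x * x)" by (intro star_shaped) auto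
  then have "h x \<le> h 1 * x" using False by (simp add: field_simps)
  also have "\<dots> \<le> h 1 * (1 + x)" using gauge_nonneg[of 1] by (simp add: algebra_simps)
  finally show ?thesis .
qed

lemma integrable_gauge:
  assumes "finite_measure M" "integrable M X" "AE x in M. 0 \<le> X x"
  shows "integrable M (\<lambda>x. h (X x))"
proof -
  interpret finite_measure M by fact
  have [measurable]: "X \<in> borel_measurable M" using assms by auto
  show ?thesis
  proof (rule Bochner_Integration.integrable_bound)
    show "integrable M (\<lambda>x. h 1 * (1 + X x))" using assms by simp
    show "AE x in M. norm (h (X x)) \<le> norm (h 1 * (1 + X x))"
      using assms(3)
    proof eventually_elim
      case (elim x)
      then show ?case using gauge_le_affine[OF elim] gauge_nonneg[OF elim] by simp
    qed
  qed measurable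
qed

lemma convex_shift: "convex_on {-\<eta><..} (\<lambda>t. - h (t + \<eta>))"
proof (rule convex_onI)
  fix t x y :: real
  assume *: "t > 0" "t < 1" "x \<in> {-\<eta><..}" "y \<in> {-\<eta><..}"
  have "(1 - t) * h (x + \<eta>) + t * h (y + \<eta>) \<le> h ((1 - t) *\<^sub>R (x + \<eta>) + t *\<^sub>R (y + \<eta>))"
    using * by (intro concave_onD[OF concave]) auto
  also have "(1 - t) *\<^sub>R (x + \<eta>) + t *\<^sub>R (y + \<eta>) = ((1 - t) *\<^sub>R x + t *\<^sub>R y) + \<eta>"
    by (simp add: algebra_simps)
  finally show "- h (((1 - t) *\<^sub>R x + t *\<^sub>R y) + \<eta>) \<le> (1 - t) * - h (x + \<eta>) + t * - h (y + \<eta>)"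
    by simp
qed simp

text \<open>A concave \<open>h\<close> may have infinite slope at \<open>0\<close> while the library's Jensen inequalities need an
  open interval, whence the shifts in the next two lemmas.\<close>

lemma jensen_less:
  assumes "prob_space M" "integrable M X" "AE x in M. 0 \<le> X x" "(LINT x|M. X x) < b"
  shows "(LINT x|M. h (X x)) \<le> h b"
proof -
  interpret prob_space M by fact
  \<comment> \<open>The whole gap below \<open>b\<close> is spent on the shift, so the shifted mean
    is exactly \<open>b\<close>.\<close>
  define \<eta> where "\<eta> = b - (LINT x|M. X x)"
  have \<eta>: "0 < \<eta>" using assms by (simp add: \<eta>_def)
  have int: "integrable M (\<lambda>x. h (X x))" "integrable M (\<lambda>x. h (X x + \<eta>))"
    using assms \<eta> by (auto intro!: integrable_gauge finite_measure_axioms)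
  have "- h (expectation X + \<eta>) \<le> expectation (\<lambda>x. - h (X x + \<eta>))"
    by (rule jensens_inequality[where I="{-\<eta><..}" and a="-\<eta>"])
       (use assms \<eta> int convex_shift in auto)
  then have "expectation (\<lambda>x. h (X x + \<eta>)) \<le> h b"
    by (simp add: \<eta>_def)
  moreover have "expectation (\<lambda>x. h (X x)) \<le> expectation (\<lambda>x. h (X x + \<eta>))"
    using \<eta> by (intro integral_mono int monoD[OF mono]) auto
  ultimately show ?thesis by simp
qed

lemma jensen_cond_exp:
  assumes "finite_measure_subalgebra M F" "integrable M X" "AE x in M. 0 \<le> X x" "0 < \<eta>"
  shows "(LINT x|M. h (X x)) \<le> (LINT x|M. h (real_cond_exp M F X x + \<eta>))"
proof -
  interpret finite_measure_subalgebra M F by fact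
  have [measurable]: "X \<in> borel_measurable M" using assms by auto
  have nonneg: "AE x in M. 0 \<le> real_cond_exp M F X x"
    using assms by (intro real_cond_exp_pos) auto
  have int: "integrable M (\<lambda>x. h (X x))" "integrable M (\<lambda>x. h (X x + \<eta>))"
    "integrable M (\<lambda>x. h (real_cond_exp M F X x + \<eta>))"
    using assms nonneg real_cond_exp_int(1)[OF assms(2)]
    by (auto intro!: integrable_gauge finite_measure_axioms)
  let ?q = "\<lambda>t. - h (t + \<eta>)"
  have "AE x in M. ?q (real_cond_exp M F X x) \<le> real_cond_exp M F (\<lambda>x. ?q (X x)) x"
    by (rule real_cond_exp_jensens_inequality(2)[where I="{-\<eta><..}" and a="-\<eta>"])
       (use assms int convex_shift in auto)
  then have "(LINT x|M. ?q (real_cond_exp M F X x)) \<le> (LINT x|M. real_cond_exp M F (\<lambda>x. ?q (X x)) x)"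
    using int by (intro integral_mono_AE real_cond_exp_int(1)) auto
  also have "\<dots> = (LINT x|M. ?q (X x))"
    using int by (intro real_cond_exp_int(2)) auto
  finally have "(LINT x|M. h (X x + \<eta>)) \<le> (LINT x|M. h (real_cond_exp M F X x + \<eta>))"
    by simp
  moreover have "(LINT x|M. h (X x)) \<le> (LINT x|M. h (X x + \<eta>))"
    using assms by (intro integral_mono int monoD[OF mono]) auto
  ultimately show ?thesis by simp
qed

end

text \<open>The set where the inequality fails lies in \<open>F\<close>. Taken as a test set, it
  forces the integral of a nonnegative function that is positive precisely there to vanish.\<close>

lemma AE_le_if_set_integral_le_subalgebra:
  fixes U W :: "'a \<Rightarrow> real"
  assumes "finite_measure_subalgebra M F"
    and int: "integrable M U" "integrable M W"
    and [measurable]: "U \<in> borel_measurable F" "W \<in> borel_measurable F"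
    and le: "\<And>B. B \<in> sets F \<Longrightarrow> (LINT x:B|M. U x) \<le> (LINT x:B|M. W x)"
  shows "AE x in M. U x \<le> W x"
proof -
  interpret finite_measure_subalgebra M F by fact
  define B where "B = {x \<in> space F. W x < U x}"
  have B: "B \<in> sets F" unfolding B_def by measurable
  then have BM: "B \<in> sets M" using subalg by (auto simp: subalgebra_def)
  have [simp]: "space F = space M" using subalg by (simp add: subalgebra_def)
  let ?g = "\<lambda>x. indicator B x *\<^sub>R U x - indicator B x *\<^sub>R W x"
  have ig: "integrable M ?g"
    by (intro Bochner_Integration.integrable_diff integrable_mult_indicator BM int)
  have nonneg: "AE x in M. 0 \<le> ?g x" by (auto simp: B_def indicator_def)
  have "(LINT x|M. ?g x) = (LINT x:B|M. U x) - (LINT x:B|M. W x)"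
    unfolding set_lebesgue_integral_def
    by (intro Bochner_Integration.integral_diff integrable_mult_indicator BM int)
  then have "(LINT x|M. ?g x) = 0"
    using le[OF B] integral_nonneg_AE[OF nonneg] by simp
  then have "AE x in M. ?g x = 0"
    using integral_nonneg_eq_0_iff_AE[OF ig nonneg] by simp
  with AE_space show ?thesis
    by eventually_elim (auto simp: B_def indicator_def split: if_splits)
qed

text \<open>The one-step inequality is required in integrated form on the events of
  \<open>F n\<close>. For a fixed event it becomes a recursion between real numbers, and a pointwise
  conditional bound is recovered only after the iteration.\<close>

locale almost_supermartingale = prob_space M
  for M :: "'a measure" +
  fixes F :: "nat \<Rightarrow> 'a measure" and V D :: "nat \<Rightarrow> 'a \<Rightarrow> real" and \<alpha> :: "nat \<Rightarrow> real" and c d :: real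
  assumes subalg: "\<And>n. subalgebra M (F n)"
    and filtration: "\<And>n. sets (F n) \<subseteq> sets (F (Suc n))"
    and adapted: "\<And>n. V n \<in> borel_measurable (F n)"
    and V_nonneg: "\<And>n x. 0 \<le> V n x"
    and V_integrable: "\<And>n. integrable M (V n)"
    and D_integrable: "\<And>n. integrable M (D n)"
    and D_nonneg: "\<And>n. AE x in M. 0 \<le> D n x"
    and D_le: "\<And>n. (LINT x|M. D n x) \<le> d"
    and \<alpha>_nonneg: "\<And>n. 0 \<le> \<alpha> n"
    and c_nonneg: "0 \<le> c"
    and step: "\<And>n B. B \<in> sets (F n) \<Longrightarrow>
      (LINT x:B|M. V (Suc n) x) \<le> (1 + c * \<alpha> n) * (LINT x:B|M. V n x) + \<alpha> n * (LINT x:B|M. D n x)"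
begin

lemma space_F [simp]: "space (F n) = space M"
  using subalg by (simp add: subalgebra_def)

lemma sets_F: "B \<in> sets (F n) \<Longrightarrow> B \<in> sets M"
  using subalg by (auto simp: subalgebra_def)

lemma sets_F_mono: "n \<le> m \<Longrightarrow> sets (F n) \<subseteq> sets (F m)"
  using lift_Suc_mono_le[of "\<lambda>n. sets (F n)"] filtration by blast

lemma finite_measure_subalgebra_F: "finite_measure_subalgebra M (F n)"
  by (intro finite_measure_subalgebra.intro finite_measure_subalgebra_axioms.intro subalg
      finite_measure_axioms)

section \<open>The process stopped on entering a set\<close>

definition X :: "real set \<Rightarrow> nat \<Rightarrow> nat \<Rightarrow> 'a \<Rightarrow> real" where
  "X Q n k x = stopped Q (\<lambda>j. V (n + j) x) k"

text \<open>The event that step \<open>k + 1\<close> still moves. It is decided at time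
  \<open>n + k\<close>, which makes stopping compatible with the one-step inequality.\<close>

definition running :: "real set \<Rightarrow> nat \<Rightarrow> nat \<Rightarrow> 'a set" where
  "running Q n k = {x \<in> space M. \<forall>j\<le>k. V (n + j) x \<notin> Q}"

lemma running_sets:
  assumes [measurable]: "Q \<in> sets borel"
  shows "running Q n k \<in> sets (F (n + k))"
proof -
  have "{x \<in> space (F (n + k)). V (n + j) x \<notin> Q} \<in> sets (F (n + k))" if "j \<le> k" for j
  proof -
    have [measurable]: "V (n + j) \<in> borel_measurable (F (n + j))" by (rule adapted)
    have "{x \<in> space (F (n + j)). V (n + j) x \<notin> Q} \<in> sets (F (n + j))" by measurable
    then show ?thesis using sets_F_mono[of "n + j" "n + k"] that by auto
  qed
  then have "(\<Inter>j\<in>{..k}. {x \<in> space (F (n + k)). V (n + j) x \<notin> Q}) \<in> sets (F (n + k))"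
    by (intro sets.finite_INT) auto
  also have "(\<Inter>j\<in>{..k}. {x \<in> space (F (n + k)). V (n + j) x \<notin> Q}) = running Q n k"
    by (auto simp: running_def)
  finally show ?thesis .
qed

lemma X_0: "X Q n 0 = V n"
  by (simp add: X_def fun_eq_iff)

lemma X_eq_V: "x \<in> running Q n k \<Longrightarrow> X Q n k x = V (n + k) x"
  by (auto simp: X_def running_def intro: stopped_eq)

text \<open>Stopping multiplies each increment by the indicator of the running event. Written this
  way, integrability and the one-step inequality reduce to those of \<open>V\<close> on events of
  the history.\<close>

lemma X_Suc:
  assumes "x \<in> space M"
  shows "X Q n (Suc k) x = X Q n k x
    + (indicator (running Q n k) x *\<^sub>R V (Suc (n + k)) x - indicator (running Q n k) x *\<^sub>R V (n + k) x)"
  using assms X_eq_V[of x Q n k] by (auto simp: X_def running_def indicator_def)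

lemma X_nonneg: "0 \<le> X Q n k x"
proof -
  have "0 \<le> stopped Q v k" if "\<And>j. 0 \<le> v j" for v :: "nat \<Rightarrow> real"
    using that by (induction k) auto
  then show ?thesis by (auto simp: X_def V_nonneg)
qed

lemma X_integrable:
  assumes Q: "Q \<in> sets borel"
  shows "integrable M (X Q n k)"
proof (induction k)
  case 0
  then show ?case by (simp add: X_0 V_integrable)
next
  case (Suc k)
  have R: "running Q n k \<in> sets M" using running_sets[OF Q] sets_F by blast
  show ?case
    by (subst Bochner_Integration.integrable_cong[OF refl X_Suc], assumption)
       (intro Bochner_Integration.integrable_add Bochner_Integration.integrable_diff Suc
         integrable_mult_indicator R V_integrable)
qed

lemma set_int: "B \<in> sets (F n) \<Longrightarrow> integrable M Y \<Longrightarrow> set_integrable M B Y"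
  for Y :: "'a \<Rightarrow> real"
  unfolding set_integrable_def by (intro integrable_mult_indicator sets_F)

text \<open>Outside \<open>R\<close> the process no longer moves, so the inequality for
  \<open>V\<close> is applied on \<open>B \<inter> R\<close>, an event known at time
  \<open>n + k\<close>.\<close>

lemma X_step:
  assumes Q: "Q \<in> sets borel" and B: "B \<in> sets (F n)"
  shows "(LINT x:B|M. X Q n (Suc k) x) \<le>
    (1 + c * \<alpha> (n + k)) * (LINT x:B|M. X Q n k x) + \<alpha> (n + k) * (LINT x:B|M. D (n + k) x)"
proof -
  let ?m = "n + k"
  define R where "R = running Q n k"
  have RF: "R \<in> sets (F ?m)" using running_sets[OF Q] by (simp add: R_def)
  have BF: "B \<in> sets (F ?m)" using sets_F_mono[of n ?m] B by auto
  have BR: "B \<inter> R \<in> sets (F ?m)" using RF BF by blast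
  have BM: "B \<in> sets M" using sets_F[OF B] .
  have RM: "R \<in> sets M" using sets_F[OF RF] .
  have BRM: "B \<inter> R \<in> sets M" using sets_F[OF BR] .
  note IX = X_integrable[OF Q, of n]
  have "(LINT x:B|M. X Q n (Suc k) x) = (LINT x|M. indicator B x *\<^sub>R X Q n k x
      + (indicator (B \<inter> R) x *\<^sub>R V (Suc ?m) x - indicator (B \<inter> R) x *\<^sub>R V ?m x))"
    unfolding set_lebesgue_integral_def
    by (intro Bochner_Integration.integral_cong refl)
       (simp add: X_Suc R_def indicator_def)
  also have "\<dots> = (LINT x:B|M. X Q n k x) + ((LINT x:B \<inter> R|M. V (Suc ?m) x) - (LINT x:B \<inter> R|M. V ?m x))"
    unfolding set_lebesgue_integral_def
    by (simp only: Bochner_Integration.integral_add Bochner_Integration.integral_diff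
        Bochner_Integration.integrable_diff integrable_mult_indicator BM BRM IX V_integrable)
  also have "\<dots> \<le> (LINT x:B|M. X Q n k x) + c * \<alpha> ?m * (LINT x:B \<inter> R|M. V ?m x)
      + \<alpha> ?m * (LINT x:B \<inter> R|M. D ?m x)"
    using step[OF BR] by (simp add: algebra_simps)
  \<comment> \<open>On \<open>R\<close> the stopped value equals \<open>V ?m\<close>; nonnegativity
    of \<open>X\<close> and \<open>D\<close> then permits the return from
    \<open>B \<inter> R\<close> to \<open>B\<close>.\<close>
  also have "\<dots> \<le> (LINT x:B|M. X Q n k x) + c * \<alpha> ?m * (LINT x:B|M. X Q n k x)
      + \<alpha> ?m * (LINT x:B|M. D ?m x)"
  proof (intro add_mono mult_left_mono order_refl)
    show "(LINT x:B \<inter> R|M. V ?m x) \<le> (LINT x:B|M. X Q n k x)"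
      unfolding set_lebesgue_integral_def
      using BM RM X_eq_V[of _ Q n k] X_nonneg
      by (intro integral_mono integrable_mult_indicator IX V_integrable)
         (auto simp: indicator_def R_def)
    show "(LINT x:B \<inter> R|M. D ?m x) \<le> (LINT x:B|M. D ?m x)"
      unfolding set_lebesgue_integral_def
      using BM RM D_nonneg[of ?m]
      by (intro integral_mono_AE integrable_mult_indicator D_integrable)
         (auto simp: indicator_def)
  qed (use \<alpha>_nonneg c_nonneg in auto)
  finally show ?thesis by (simp add: algebra_simps)
qed

lemma set_integral_nonneg_D: "B \<in> sets (F n) \<Longrightarrow> 0 \<le> (LINT x:B|M. D m x)"
  using D_nonneg[of m] unfolding set_lebesgue_integral_def
  by (intro integral_nonneg_AE) (auto simp: indicator_def)

lemma X_gronwall: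
  assumes Q: "Q \<in> sets borel" and B: "B \<in> sets (F n)"
  shows "(LINT x:B|M. X Q n k x) \<le> exp (c * (\<Sum>i<k. \<alpha> (n + i))) *
    ((LINT x:B|M. V n x) + (\<Sum>i<k. \<alpha> (n + i) * (LINT x:B|M. D (n + i) x)))"
proof -
  have "(LINT x:B|M. X Q n k x) + (\<Sum>i<k. 0) \<le> exp (\<Sum>i<k. c * \<alpha> (n + i)) *
    ((LINT x:B|M. X Q n 0 x) + (\<Sum>i<k. \<alpha> (n + i) * (LINT x:B|M. D (n + i) x)))"
  proof (rule discrete_gronwall)
    show "0 \<le> (LINT x:B|M. X Q n k x)" for k
      unfolding set_lebesgue_integral_def
      by (intro integral_nonneg_AE) (auto simp: X_nonneg)
  qed (use X_step[OF Q B] \<alpha>_nonneg c_nonneg set_integral_nonneg_D[OF B] in auto)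
  then show ?thesis by (simp add: X_0 sum_distrib_left)
qed

text \<open>The factor \<open>exp (- K)\<close> cancels the Gronwall factor, so conditioning on
  \<open>F n\<close> leaves \<open>V n\<close> with coefficient at most 1, and subadditivity keeps
  \<open>h (V n x)\<close> without loss. The noise contributes \<open>h b\<close> by Jensen's
  inequality.\<close>

lemma gauge_X_bound:
  assumes h: "concave_gauge h" and Q: "Q \<in> sets borel"
    and K: "c * (\<Sum>i<k. \<alpha> (n + i)) \<le> K" and b: "d * (\<Sum>i<k. \<alpha> (n + i)) < b"
  shows "(LINT x|M. h (exp (- K) * X Q n k x)) \<le> (LINT x|M. h (V n x)) + h b"
proof -
  interpret h: concave_gauge h by fact
  interpret F: finite_measure_subalgebra M "F n" by (rule finite_measure_subalgebra_F)
  define R where "R x = (\<Sum>i<k. \<alpha> (n + i) * D (n + i) x)" for x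
  define S where "S = real_cond_exp M (F n) R"
  define Y where "Y x = exp (- K) * X Q n k x" for x
  define E where "E = real_cond_exp M (F n) Y"
  have intR: "integrable M R" unfolding R_def using D_integrable by auto
  have intY: "integrable M Y" unfolding Y_def using X_integrable[OF Q] by auto
  have intS: "integrable M S" and intE: "integrable M E"
    unfolding S_def E_def using F.real_cond_exp_int(1) intR intY by auto
  have R_nonneg: "AE x in M. 0 \<le> R x"
  proof -
    have "AE x in M. \<forall>i. 0 \<le> D (n + i) x"
      using D_nonneg by (auto simp: AE_all_countable)
    then show ?thesis
      by eventually_elim (auto simp: R_def intro!: sum_nonneg mult_nonneg_nonneg \<alpha>_nonneg)
  qed
  have S_nonneg: "AE x in M. 0 \<le> S x" unfolding S_def
    using R_nonneg intR by (intro F.real_cond_exp_pos) auto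
  have E_nonneg: "AE x in M. 0 \<le> E x" unfolding E_def
    using X_nonneg intY by (intro F.real_cond_exp_pos) (auto simp: Y_def)
  have "(LINT x|M. S x) = (LINT x|M. R x)"
    unfolding S_def by (rule F.real_cond_exp_int(2)[OF intR])
  also have "\<dots> = (\<Sum>i<k. \<alpha> (n + i) * (LINT x|M. D (n + i) x))"
    unfolding R_def using D_integrable by simp
  also have "\<dots> \<le> (\<Sum>i<k. \<alpha> (n + i) * d)"
    by (intro sum_mono mult_left_mono D_le \<alpha>_nonneg)
  also have "\<dots> < b"
    using b by (simp add: sum_distrib_left mult.commute)
  finally have Sb: "(LINT x|M. S x) < b" .
  \<comment> \<open>Conditional Jensen consumes a positive shift. Half of the gap keeps the mean of
    \<open>S x + \<eta>\<close> strictly below \<open>b\<close> for the second use of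
    Jensen.\<close>
  define \<eta> where "\<eta> = (b - (LINT x|M. S x)) / 2"
  have \<eta>: "0 < \<eta>" using Sb by (simp add: \<eta>_def)
  have "AE x in M. E x \<le> V n x + S x"
  proof (rule AE_le_if_set_integral_le_subalgebra[OF finite_measure_subalgebra_F intE])
    show "integrable M (\<lambda>x. V n x + S x)" using V_integrable intS by auto
    show "E \<in> borel_measurable (F n)" by (simp add: E_def)
    show "(\<lambda>x. V n x + S x) \<in> borel_measurable (F n)" using adapted by (auto simp: S_def)
    fix B assume B: "B \<in> sets (F n)"
    have sR: "(LINT x:B|M. R x) = (\<Sum>i<k. \<alpha> (n + i) * (LINT x:B|M. D (n + i) x))"
    proof -
      have "(LINT x:B|M. R x) = (LINT x|M. (\<Sum>i<k. \<alpha> (n + i) * (indicator B x *\<^sub>R D (n + i) x)))"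
        unfolding set_lebesgue_integral_def R_def
        by (intro Bochner_Integration.integral_cong refl) (simp add: sum_distrib_left mult.left_commute)
      also have "\<dots> = (\<Sum>i<k. \<alpha> (n + i) * (LINT x:B|M. D (n + i) x))"
        unfolding set_lebesgue_integral_def
        using integrable_mult_indicator[OF sets_F[OF B] D_integrable]
        by (subst Bochner_Integration.integral_sum) auto
      finally show ?thesis .
    qed
    have V0: "0 \<le> (LINT x:B|M. V n x)"
      unfolding set_lebesgue_integral_def by (intro integral_nonneg_AE) (auto simp: V_nonneg)
    have s0: "0 \<le> (\<Sum>i<k. \<alpha> (n + i) * (LINT x:B|M. D (n + i) x))"
      using set_integral_nonneg_D[OF B] \<alpha>_nonneg by (auto intro!: sum_nonneg mult_nonneg_nonneg)
    have "(LINT x:B|M. E x) = (LINT x:B|M. Y x)"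
      unfolding E_def by (rule F.real_cond_exp_intA[OF intY B, symmetric])
    also have "\<dots> = exp (- K) * (LINT x:B|M. X Q n k x)"
      by (simp add: Y_def)
    also have "\<dots> \<le> exp (- K) * (exp (c * (\<Sum>i<k. \<alpha> (n + i))) *
        ((LINT x:B|M. V n x) + (LINT x:B|M. R x)))"
      using X_gronwall[OF Q B, of k] by (simp add: sR)
    also have "\<dots> = exp (c * (\<Sum>i<k. \<alpha> (n + i)) - K) * ((LINT x:B|M. V n x) + (LINT x:B|M. R x))"
      by (simp add: exp_diff exp_minus field_simps)
    \<comment> \<open>The exponent is at most 0 by the choice of \<open>K\<close>.\<close>
    also have "\<dots> \<le> (LINT x:B|M. V n x) + (LINT x:B|M. R x)"
      using K V0 s0 sR by (intro mult_left_le_one_le) auto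
    also have "(LINT x:B|M. R x) = (LINT x:B|M. S x)"
      unfolding S_def by (rule F.real_cond_exp_intA[OF intR B])
    also have "(LINT x:B|M. V n x) + (LINT x:B|M. S x) = (LINT x:B|M. V n x + S x)"
      by (rule set_integral_add(2)[symmetric]) (intro set_int[OF B] V_integrable intS)+
    finally show "(LINT x:B|M. E x) \<le> (LINT x:B|M. V n x + S x)" .
  qed
  note E_le = this
  have fin: "finite_measure M" by (rule finite_measure_axioms)
  have "(LINT x|M. h (Y x)) \<le> (LINT x|M. h (E x + \<eta>))"
    unfolding E_def using X_nonneg \<eta> X_integrable[OF Q]
    by (intro h.jensen_cond_exp finite_measure_subalgebra_F) (auto simp: Y_def)
  also have "\<dots> \<le> (LINT x|M. h (V n x) + h (S x + \<eta>))"
  proof (rule integral_mono_AE)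
    show "integrable M (\<lambda>x. h (E x + \<eta>))" using intE E_nonneg \<eta>
      by (intro h.integrable_gauge fin) auto
    show "integrable M (\<lambda>x. h (V n x) + h (S x + \<eta>))" using V_integrable intS S_nonneg \<eta> V_nonneg
      by (intro Bochner_Integration.integrable_add h.integrable_gauge fin) auto
    show "AE x in M. h (E x + \<eta>) \<le> h (V n x) + h (S x + \<eta>)"
      using E_le S_nonneg
    proof eventually_elim
      case (elim x)
      then have "h (E x + \<eta>) \<le> h (V n x + (S x + \<eta>))"
        by (intro monoD[OF h.mono]) auto
      also have "\<dots> \<le> h (V n x) + h (S x + \<eta>)"
        using elim \<eta> V_nonneg by (intro h.subadditive) auto
      finally show ?case .
    qed
  qed
  also have "\<dots> = (LINT x|M. h (V n x)) + (LINT x|M. h (S x + \<eta>))"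
    using V_integrable intS S_nonneg \<eta> V_nonneg
    by (intro Bochner_Integration.integral_add h.integrable_gauge fin) auto
  also have "(LINT x|M. h (S x + \<eta>)) \<le> h b"
    using intS S_nonneg \<eta> Sb
    by (intro h.jensen_less prob_space_axioms) (auto simp: prob_space \<eta>_def field_simps)
  finally show ?thesis by (simp add: Y_def)
qed

text \<open>With an empty target set the process is never stopped.\<close>

lemma gauge_V_bound:
  assumes h: "concave_gauge h" and K: "c * (\<Sum>i<k. \<alpha> (n + i)) \<le> K"
    and b: "d * (\<Sum>i<k. \<alpha> (n + i)) < b"
  shows "(LINT x|M. h (exp (- K) * V (n + k) x)) \<le> (LINT x|M. h (V n x)) + h b"
proof -
  have "X {} n k = V (n + k)" by (rule ext) (simp add: X_def stopped_eq)
  with gauge_X_bound[OF h _ K b, of "{}"] show ?thesis by simp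
qed

text \<open>Markov's inequality for the stopped process: once \<open>V\<close> has reached
  \<open>t\<close>, the process is frozen at a value of at least \<open>t\<close>. The bound does
  not depend on the horizon \<open>k\<close>, so it passes to the union of the increasing events
  \<open>A k\<close>.\<close>

lemma gauge_maximal_inequality:
  assumes h: "concave_gauge h" and K: "\<And>k. c * (\<Sum>i<k. \<alpha> (n + i)) \<le> K"
    and b: "\<And>k. d * (\<Sum>i<k. \<alpha> (n + i)) < b" and t: "0 \<le> t"
  shows "prob {x \<in> space M. \<exists>m\<ge>n. t \<le> V m x} * h (exp (- K) * t) \<le> (LINT x|M. h (V n x)) + h b"
proof -
  interpret h: concave_gauge h by fact
  define A where "A k = space M - running {t..} n k" for k
  have R: "running {t..} n k \<in> sets M" for k
    using running_sets[of "{t..}" n k] sets_F by auto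
  have A: "A k \<in> sets M" for k
    unfolding A_def using R by auto
  have "prob (A k) * h (exp (- K) * t) \<le> (LINT x|M. h (V n x)) + h b" for k
  proof -
    have "prob (A k) * h (exp (- K) * t) = (LINT x|M. indicator (A k) x *\<^sub>R h (exp (- K) * t))"
      using A by simp
    also have "\<dots> \<le> (LINT x|M. h (exp (- K) * X {t..} n k x))"
    proof (rule integral_mono)
      show "integrable M (\<lambda>x. h (exp (- K) * X {t..} n k x))"
        using X_integrable[of "{t..}" n k] X_nonneg
        by (intro h.integrable_gauge finite_measure_axioms) auto
      show "integrable M (\<lambda>x. indicator (A k) x *\<^sub>R h (exp (- K) * t))"
        using A by (intro integrable_mult_indicator) auto
      fix x assume x: "x \<in> space M"
      show "indicator (A k) x *\<^sub>R h (exp (- K) * t) \<le> h (exp (- K) * X {t..} n k x)"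
      proof (cases "x \<in> A k")
        case True
        then have "\<exists>j\<le>k. V (n + j) x \<in> {t..}" by (auto simp: A_def running_def)
        then have "X {t..} n k x \<in> {t..}" unfolding X_def by (rule stopped_mem)
        with True show ?thesis by (auto intro!: monoD[OF h.mono])
      next
        case False
        then show ?thesis using X_nonneg by (simp add: h.gauge_nonneg)
      qed
    qed
    also have "\<dots> \<le> (LINT x|M. h (V n x)) + h b"
      by (rule gauge_X_bound[OF h _ K b]) simp
    finally show ?thesis .
  qed
  moreover have "(\<lambda>k. prob (A k)) \<longlonglongrightarrow> prob (\<Union>k. A k)"
  proof (rule finite_Lim_measure_incseq)
    show "range A \<subseteq> sets M" using A by blast
    have "running {t..} n k \<supseteq> running {t..} n l" if "k \<le> l" for k l
      using that unfolding running_def by (blast intro: order_trans)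
    then show "incseq A" unfolding incseq_def A_def by blast
  qed
  ultimately have "prob (\<Union>k. A k) * h (exp (- K) * t) \<le> (LINT x|M. h (V n x)) + h b"
    by (intro LIMSEQ_le_const2[OF tendsto_mult_right]) blast+
  also have "(\<Union>k. A k) = {x \<in> space M. \<exists>m\<ge>n. t \<le> V m x}"
  proof -
    have "(\<exists>m\<ge>n. t \<le> V m x) \<longleftrightarrow> (\<exists>k. \<exists>j\<le>k. t \<le> V (n + j) x)" for x
    proof
      assume "\<exists>m\<ge>n. t \<le> V m x"
      then obtain j where "t \<le> V (n + j) x" by (metis le_Suc_ex)
      then show "\<exists>k. \<exists>j\<le>k. t \<le> V (n + j) x" by blast
    qed (metis le_add1)
    then show ?thesis unfolding A_def running_def by fastforce
  qed
  finally show ?thesis .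
qed

end

subsection \<open>The stochastic iteration\<close>

text \<open>The values of \<open>f\<close> at negative arguments are arbitrary. Replacing them by
  \<open>f 0\<close> gives monotonicity on the whole line and changes nothing on the
  half-line.\<close>

lemma sicc_imp_concave_gauge:
  assumes "sicc f \<psi> \<kappa>"
  shows "concave_gauge (\<lambda>t. f (max 0 t))"
proof
  have strict: "strict_mono_on {0..} f" and conc: "concave_on {0..} f" and "f 0 = 0"
    using assms by (auto simp: sicc_def)
  have "f x \<le> f y" if "0 \<le> x" "x \<le> y" for x y
    using strict_mono_on_leD[OF strict, of x y] that by auto
  then show "mono (\<lambda>t. f (max 0 t))"
    by (auto simp: mono_def)
  have "- f (max 0 ((1 - t) *\<^sub>R x + t *\<^sub>R y)) \<le> (1 - t) * - f (max 0 x) + t * - f (max 0 y)"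
    if "0 < t" "t < 1" "0 \<le> x" "0 \<le> y" for t x y :: real
    using concave_onD[OF conc, of t x y] that by (simp add: max_absorb2)
  then show "concave_on {0..} (\<lambda>t. f (max 0 t))"
    unfolding concave_on_def by (intro convex_onI) auto
  show "f (max 0 0) = 0" using \<open>f 0 = 0\<close> by simp
qed

text \<open>Used with \<open>N = 0\<close> to bound every block by the full sum, and with
  \<open>N\<close> from the rate of convergence to bound it by a tail.\<close>

lemma sum_shift_le_suminf:
  fixes s :: "nat \<Rightarrow> real"
  assumes "summable s" "\<And>i. 0 \<le> s i" "N \<le> n"
  shows "(\<Sum>i<k. s (n + i)) \<le> (\<Sum>i. s (i + N))"
proof -
  obtain m where m: "n = m + N" using assms(3) by (metis add.commute le_Suc_ex)
  have sm: "summable (\<lambda>i. s (i + N))" using assms(1) by (rule summable_ignore_initial_segment)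
  have "(\<Sum>i<k. s (n + i)) = (\<Sum>i\<in>{m..<m + k}. s (i + N))"
    unfolding m by (rule sum.reindex_bij_witness[of _ "\<lambda>i. i - m" "\<lambda>i. m + i"]) (auto simp: ac_simps)
  also have "\<dots> \<le> (\<Sum>i. s (i + N))"
    by (rule sum_le_suminf[OF sm]) (auto simp: assms)
  finally show ?thesis .
qed

lemma sets_history:
  assumes "\<And>i. x i \<in> borel_measurable P" "\<And>i. y i \<in> borel_measurable P"
  shows "sets (history P x y n) = sigma_sets (space P)
     (\<Union>i<n. {x i -` A \<inter> space P |A. A \<in> sets borel} \<union> {y i -` A \<inter> space P |A. A \<in> sets borel})"
  unfolding history_def by (rule sets_measure_of) auto

lemma power2_norm_diff_scaleR:
  fixes u v :: "'a::real_inner"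
  shows "(norm (u - t *\<^sub>R v))\<^sup>2 = (norm u)\<^sup>2 - 2 * t * inner u v + t\<^sup>2 * (norm v)\<^sup>2"
  unfolding power2_norm_eq_inner
  by (simp add: inner_diff_left inner_diff_right inner_commute[of v u] power2_eq_square algebra_simps)

locale stochastic_iteration = prob_space P
  for P :: "'w measure" +
  fixes x0 z :: "'h::{real_inner, banach, second_countable_topology}"
    and x y :: "nat \<Rightarrow> 'w \<Rightarrow> 'h" and a :: "nat \<Rightarrow> real" and D :: "nat \<Rightarrow> 'w \<Rightarrow> real" and c d :: real
  assumes y_measurable [measurable]: "\<And>n. y n \<in> borel_measurable P"
    and a_nonneg: "\<And>n. 0 \<le> a n"
    and x_0: "\<And>\<omega>. x 0 \<omega> = x0"
    and x_Suc: "\<And>n \<omega>. x (Suc n) \<omega> = x n \<omega> - a n *\<^sub>R y n \<omega>"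
    and c_nonneg: "0 \<le> c" and d_nonneg: "0 \<le> d"
    and D_measurable [measurable]: "\<And>n. D n \<in> borel_measurable P"
    and D_nonneg: "\<And>n. AE \<omega> in P. 0 \<le> D n \<omega>"
    and D_bound: "(SUP n. \<integral>\<^sup>+ \<omega>. ennreal (D n \<omega>) \<partial>P) \<le> ennreal d"
    and cond_i: "\<And>n. AE \<omega> in P.
       nn_cond_exp P (history P x y n) (\<lambda>\<omega>. ennreal ((norm (y n \<omega>))\<^sup>2)) \<omega>
         \<le> ennreal (c * (norm (x n \<omega> - z))\<^sup>2 + D n \<omega>)"
    and cond_ii: "\<And>n. AE \<omega> in P.
       0 \<le> inner (x n \<omega> - z) (cond_exp P (history P x y n) (y n) \<omega>)"
begin

section \<open>Measurability, moments and drift of the iterates\<close>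

abbreviation "V n \<omega> \<equiv> (norm (x n \<omega> - z))\<^sup>2"
abbreviation "\<phi> n \<omega> \<equiv> inner (x n \<omega> - z) (cond_exp P (history P x y n) (y n) \<omega>)"

lemma x_measurable [measurable]: "x n \<in> borel_measurable P"
proof (induction n)
  case 0
  have "x 0 = (\<lambda>\<omega>. x0)" using x_0 by auto
  then show ?case by simp
next
  case (Suc n)
  note [measurable] = Suc
  have "x (Suc n) = (\<lambda>\<omega>. x n \<omega> - a n *\<^sub>R y n \<omega>)" using x_Suc by auto
  then show ?case by simp
qed

lemmas sets_hist = sets_history[OF x_measurable y_measurable]

lemma space_hist [simp]: "space (history P x y n) = space P"
  unfolding history_def by (rule space_measure_of) auto

lemma subalgebra_hist: "subalgebra P (history P x y n)"
  unfolding subalgebra_def sets_hist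
  by (auto intro!: sets.sigma_sets_subset)

lemma hist_mono: "sets (history P x y n) \<subseteq> sets (history P x y (Suc n))"
  unfolding sets_hist by (intro sigma_sets_mono' UN_mono) auto

lemma history_measurable:
  assumes "i < n"
  shows "x i \<in> borel_measurable (history P x y n)" "y i \<in> borel_measurable (history P x y n)"
proof -
  have "x i -` A \<inter> space P \<in> sets (history P x y n)" "y i -` A \<inter> space P \<in> sets (history P x y n)"
    if "A \<in> sets borel" for A
    unfolding sets_hist using assms that by (auto intro!: sigma_sets.Basic UN_I[of i])
  then show "x i \<in> borel_measurable (history P x y n)" "y i \<in> borel_measurable (history P x y n)"
    by (auto intro!: measurableI)
qed

text \<open>The history at \<open>n\<close> is generated by indices below \<open>n\<close> only, but
  these determine \<open>x n\<close> through the recursion, and \<open>x 0\<close> is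
  constant.\<close>

lemma x_adapted [measurable]: "x n \<in> borel_measurable (history P x y n)"
proof (cases n)
  case 0
  have "x 0 = (\<lambda>\<omega>. x0)" using x_0 by auto
  then show ?thesis using 0 by simp
next
  case (Suc m)
  have [measurable]: "x m \<in> borel_measurable (history P x y n)" "y m \<in> borel_measurable (history P x y n)"
    using history_measurable[of m n] Suc by auto
  have "x n = (\<lambda>\<omega>. x m \<omega> - a m *\<^sub>R y m \<omega>)" using x_Suc Suc by auto
  then show ?thesis by simp
qed

lemma V_adapted [measurable]: "V n \<in> borel_measurable (history P x y n)"
  by measurable

lemma finite_measure_subalgebra_hist: "finite_measure_subalgebra P (history P x y n)"
  by (intro finite_measure_subalgebra.intro finite_measure_subalgebra_axioms.intro subalgebra_hist
      finite_measure_axioms)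

lemma nn_integral_D_le: "(\<integral>\<^sup>+ \<omega>. ennreal (D n \<omega>) \<partial>P) \<le> ennreal d"
  using D_bound by (meson SUP_upper UNIV_I order_trans)

lemma D_integrable: "integrable P (D n)"
proof (rule integrableI_nonneg)
  show "(\<integral>\<^sup>+ \<omega>. ennreal (D n \<omega>) \<partial>P) < \<infinity>"
    using nn_integral_D_le[of n] by (simp add: order_le_less_trans)
qed (use D_nonneg in auto)

lemma D_le: "expectation (D n) \<le> d"
  using nn_integral_D_le[of n] d_nonneg
  by (simp add: nn_integral_eq_integral[OF D_integrable D_nonneg])

text \<open>Extended nonnegative integrals are used because square integrability of
  \<open>y n\<close> is itself derived from this bound.\<close>

lemma nn_integral_y_le:
  assumes B: "B \<in> sets (history P x y n)"
  shows "(\<integral>\<^sup>+ \<omega>. indicator B \<omega> * ennreal ((norm (y n \<omega>))\<^sup>2) \<partial>P)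
    \<le> (\<integral>\<^sup>+ \<omega>. indicator B \<omega> * ennreal (c * V n \<omega> + D n \<omega>) \<partial>P)"
proof -
  interpret F: finite_measure_subalgebra P "history P x y n" by (rule finite_measure_subalgebra_hist)
  have "(\<integral>\<^sup>+ \<omega>. indicator B \<omega> * ennreal ((norm (y n \<omega>))\<^sup>2) \<partial>P) = (\<integral>\<^sup>+ \<omega>. indicator B \<omega> *
      nn_cond_exp P (history P x y n) (\<lambda>\<omega>. ennreal ((norm (y n \<omega>))\<^sup>2)) \<omega> \<partial>P)"
    using B by (intro F.nn_cond_exp_intg[symmetric]) auto
  also have "\<dots> \<le> (\<integral>\<^sup>+ \<omega>. indicator B \<omega> * ennreal (c * V n \<omega> + D n \<omega>) \<partial>P)"
    by (intro nn_integral_mono_AE, use cond_i[of n] in eventually_elim) (auto intro: mult_left_mono)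
  finally show ?thesis .
qed

lemma y_square_integrable:
  assumes V: "integrable P (V n)"
  shows "integrable P (\<lambda>\<omega>. (norm (y n \<omega>))\<^sup>2)"
proof (rule integrableI_nonneg)
  have "integrable P (\<lambda>\<omega>. c * V n \<omega> + D n \<omega>)" using V D_integrable by simp
  then have "(\<integral>\<^sup>+ \<omega>. ennreal (c * V n \<omega> + D n \<omega>) \<partial>P) < \<infinity>"
    using D_nonneg[of n] c_nonneg by (subst nn_integral_eq_integral) auto
  moreover have "(\<integral>\<^sup>+ \<omega>. ennreal ((norm (y n \<omega>))\<^sup>2) \<partial>P) \<le> (\<integral>\<^sup>+ \<omega>. ennreal (c * V n \<omega> + D n \<omega>) \<partial>P)"
  proof -
    have "space P \<in> sets (history P x y n)" using sets.top[of "history P x y n"] by simp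
    moreover have "(\<integral>\<^sup>+ \<omega>. indicator (space P) \<omega> * g \<omega> \<partial>P) = (\<integral>\<^sup>+ \<omega>. g \<omega> \<partial>P)"
      for g :: "'w \<Rightarrow> ennreal"
      by (intro nn_integral_cong) simp
    ultimately show ?thesis using nn_integral_y_le[of "space P" n] by simp
  qed
  ultimately show "(\<integral>\<^sup>+ \<omega>. ennreal ((norm (y n \<omega>))\<^sup>2) \<partial>P) < \<infinity>"
    by (rule order_le_less_trans[rotated])
qed auto

lemma V_Suc: "V (Suc n) \<omega> = V n \<omega> - 2 * a n * inner (x n \<omega> - z) (y n \<omega>) + (a n)\<^sup>2 * (norm (y n \<omega>))\<^sup>2"
proof -
  have "x (Suc n) \<omega> - z = (x n \<omega> - z) - a n *\<^sub>R y n \<omega>" by (simp add: x_Suc)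
  then show ?thesis by (simp only: power2_norm_diff_scaleR)
qed

lemma inner_integrable:
  assumes V: "integrable P (V n)"
  shows "integrable P (\<lambda>\<omega>. inner (x n \<omega> - z) (y n \<omega>))"
proof (rule Bochner_Integration.integrable_bound)
  show "integrable P (\<lambda>\<omega>. V n \<omega> + (norm (y n \<omega>))\<^sup>2)" using V y_square_integrable by simp
  show "AE \<omega> in P. norm (inner (x n \<omega> - z) (y n \<omega>)) \<le> norm (V n \<omega> + (norm (y n \<omega>))\<^sup>2)"
  proof (rule AE_I2)
    fix \<omega>
    let ?p = "norm (x n \<omega> - z)" and ?q = "norm (y n \<omega>)"
    have "\<bar>inner (x n \<omega> - z) (y n \<omega>)\<bar> \<le> ?p * ?q" by (rule Cauchy_Schwarz_ineq2)
    also have "\<dots> \<le> ?p\<^sup>2 + ?q\<^sup>2"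
      using sum_squares_bound[of ?p ?q, unfolded mult.assoc] mult_nonneg_nonneg[OF norm_ge_zero norm_ge_zero, of "x n \<omega> - z" "y n \<omega>"]
      by linarith
    finally show "norm (inner (x n \<omega> - z) (y n \<omega>)) \<le> norm (?p\<^sup>2 + ?q\<^sup>2)" by simp
  qed
qed measurable

text \<open>Integrability of \<open>V n\<close> gives that of the squared norm of \<open>y n\<close>
  and of the cross term, hence that of \<open>V (Suc n)\<close>. This is why the preceding lemmas
  take it as a hypothesis.\<close>

lemma V_integrable: "integrable P (V n)"
proof (induction n)
  case 0
  then show ?case by (simp add: x_0)
next
  case (Suc n)
  then show ?case
    unfolding V_Suc
    by (intro Bochner_Integration.integrable_add Bochner_Integration.integrable_diff
        integrable_mult_right inner_integrable y_square_integrable)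
qed

lemmas y_sq_integrable = y_square_integrable[OF V_integrable]

lemma y_integrable: "integrable P (y n)"
proof (rule Bochner_Integration.integrable_bound)
  show "integrable P (\<lambda>\<omega>. 1 + (norm (y n \<omega>))\<^sup>2)" using y_sq_integrable by simp
  show "AE \<omega> in P. norm (y n \<omega>) \<le> norm (1 + (norm (y n \<omega>))\<^sup>2)"
  proof (rule AE_I2)
    fix \<omega>
    have "2 * norm (y n \<omega>) \<le> 1 + (norm (y n \<omega>))\<^sup>2"
      using sum_squares_bound[of 1 "norm (y n \<omega>)"] by simp
    then have "norm (y n \<omega>) \<le> 1 + (norm (y n \<omega>))\<^sup>2"
      using norm_ge_zero[of "y n \<omega>"] by linarith
    then show "norm (y n \<omega>) \<le> norm (1 + (norm (y n \<omega>))\<^sup>2)" by simp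
  qed
qed measurable

text \<open>Since \<open>y n\<close> is integrable a version exists, so the choice made in
  \<open>cond_exp\<close> is a genuine conditional expectation.\<close>

lemma is_cond_exp_y: "is_cond_exp P (history P x y n) (y n) (cond_exp P (history P x y n) (y n))"
  unfolding cond_exp_def
  using finite_measure_subalgebra.is_cond_exp_exists[OF finite_measure_subalgebra_hist y_integrable]
  by (rule someI_ex)

text \<open>The direction \<open>x n - z\<close>, cut down to \<open>B\<close>, is known to the
  history but possibly unbounded; \<open>cond_ii\<close> supplies the sign that replaces
  boundedness.\<close>

lemma integral_\<phi>:
  assumes B: "B \<in> sets (history P x y n)"
  shows "(LINT \<omega>:B|P. \<phi> n \<omega>) = (LINT \<omega>:B|P. inner (x n \<omega> - z) (y n \<omega>))"
proof -
  have BP: "B \<in> sets P" using B subalgebra_hist by (auto simp: subalgebra_def)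
  have "(LINT \<omega>|P. inner (indicator B \<omega> *\<^sub>R (x n \<omega> - z)) (cond_exp P (history P x y n) (y n) \<omega>))
      = (LINT \<omega>|P. inner (indicator B \<omega> *\<^sub>R (x n \<omega> - z)) (y n \<omega>))"
  proof (rule finite_measure_subalgebra.integral_inner_cond_exp_nonneg(2)[OF
        finite_measure_subalgebra_hist is_cond_exp_y])
    show "(\<lambda>\<omega>. indicator B \<omega> *\<^sub>R (x n \<omega> - z)) \<in> borel_measurable (history P x y n)"
      using B by measurable
    show "integrable P (\<lambda>\<omega>. inner (indicator B \<omega> *\<^sub>R (x n \<omega> - z)) (y n \<omega>))"
      using integrable_mult_indicator[OF BP inner_integrable[OF V_integrable]] by simp
    show "AE \<omega> in P. 0 \<le> inner (indicator B \<omega> *\<^sub>R (x n \<omega> - z)) (cond_exp P (history P x y n) (y n) \<omega>)"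
      using cond_ii[of n] by eventually_elim (auto simp: indicator_def)
  qed
  then show ?thesis by (simp add: set_lebesgue_integral_def)
qed

lemma integral_\<phi>_nonneg: "0 \<le> (LINT \<omega>:B|P. \<phi> n \<omega>)"
  unfolding set_lebesgue_integral_def
  by (intro integral_nonneg_AE, use cond_ii[of n] in eventually_elim) (auto simp: indicator_def)

text \<open>In the expanded square, conditioning turns the cross term into the drift
  \<open>\<phi>\<close>, and \<open>cond_i\<close> controls the second moment of \<open>y n\<close>.
  The drift stays on the left because its weighted sum is to be bounded.\<close>

lemma one_step:
  assumes B: "B \<in> sets (history P x y n)"
  shows "(LINT \<omega>:B|P. V (Suc n) \<omega>) + 2 * a n * (LINT \<omega>:B|P. \<phi> n \<omega>)
    \<le> (1 + c * (a n)\<^sup>2) * (LINT \<omega>:B|P. V n \<omega>) + (a n)\<^sup>2 * (LINT \<omega>:B|P. D n \<omega>)"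
proof -
  have BP: "B \<in> sets P" using B subalgebra_hist by (auto simp: subalgebra_def)
  let ?y2 = "\<lambda>\<omega>. (norm (y n \<omega>))\<^sup>2"
  have si: "set_integrable P B g" if "integrable P g" for g :: "'w \<Rightarrow> real"
    unfolding set_integrable_def by (rule integrable_mult_indicator[OF BP that])
  have y2: "(LINT \<omega>:B|P. ?y2 \<omega>) \<le> c * (LINT \<omega>:B|P. V n \<omega>) + (LINT \<omega>:B|P. D n \<omega>)"
  proof -
    have W: "integrable P (\<lambda>\<omega>. c * V n \<omega> + D n \<omega>)" using V_integrable D_integrable by simp
    have nn: "(\<integral>\<^sup>+ \<omega>. indicator B \<omega> * ennreal (g \<omega>) \<partial>P) = ennreal (LINT \<omega>:B|P. g \<omega>)"
      if g: "integrable P g" "AE \<omega> in P. 0 \<le> g \<omega>" for g :: "'w \<Rightarrow> real"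
    proof -
      have "AE \<omega> in P. \<omega> \<in> B \<longrightarrow> 0 \<le> g \<omega>" using g(2) by eventually_elim simp
      from nn_set_integral_eq_set_integral[OF g(1) this BP] show ?thesis
        by (simp add: mult.commute)
    qed
    have W_nonneg: "AE \<omega> in P. 0 \<le> c * V n \<omega> + D n \<omega>"
      using D_nonneg[of n] by eventually_elim (simp add: c_nonneg)
    have "ennreal (LINT \<omega>:B|P. ?y2 \<omega>) = (\<integral>\<^sup>+ \<omega>. indicator B \<omega> * ennreal (?y2 \<omega>) \<partial>P)"
      by (rule nn[OF y_sq_integrable, symmetric]) simp
    also have "\<dots> \<le> (\<integral>\<^sup>+ \<omega>. indicator B \<omega> * ennreal (c * V n \<omega> + D n \<omega>) \<partial>P)"
      by (rule nn_integral_y_le[OF B])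
    also have "\<dots> = ennreal (LINT \<omega>:B|P. c * V n \<omega> + D n \<omega>)"
      by (rule nn[OF W W_nonneg])
    finally have "ennreal (LINT \<omega>:B|P. ?y2 \<omega>) \<le> ennreal (LINT \<omega>:B|P. c * V n \<omega> + D n \<omega>)" .
    moreover have "0 \<le> (LINT \<omega>:B|P. c * V n \<omega> + D n \<omega>)"
      unfolding set_lebesgue_integral_def
      by (intro integral_nonneg_AE, use W_nonneg in eventually_elim) (simp add: indicator_def)
    ultimately have "(LINT \<omega>:B|P. ?y2 \<omega>) \<le> (LINT \<omega>:B|P. c * V n \<omega> + D n \<omega>)"
      by (simp add: ennreal_le_iff)
    also have "\<dots> = c * (LINT \<omega>:B|P. V n \<omega>) + (LINT \<omega>:B|P. D n \<omega>)"
      using set_integral_add(2)[OF si[OF integrable_mult_right[OF V_integrable, of c]] si[OF D_integrable]]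
      by simp
    finally show ?thesis .
  qed
  have "(LINT \<omega>:B|P. V (Suc n) \<omega>) = (LINT \<omega>:B|P. V n \<omega>)
      - 2 * a n * (LINT \<omega>:B|P. inner (x n \<omega> - z) (y n \<omega>)) + (a n)\<^sup>2 * (LINT \<omega>:B|P. ?y2 \<omega>)"
  proof -
    have i: "set_integrable P B (V n)"
      "set_integrable P B (\<lambda>\<omega>. 2 * a n * inner (x n \<omega> - z) (y n \<omega>))"
      "set_integrable P B (\<lambda>\<omega>. (a n)\<^sup>2 * ?y2 \<omega>)"
      by (intro si integrable_mult_right V_integrable inner_integrable y_sq_integrable)+
    show ?thesis
      unfolding V_Suc set_integral_add(2)[OF set_integral_diff(1)[OF i(1,2)] i(3)]
        set_integral_diff(2)[OF i(1,2)] by simp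
  qed
  also have "\<dots> \<le> (LINT \<omega>:B|P. V n \<omega>) - 2 * a n * (LINT \<omega>:B|P. \<phi> n \<omega>)
      + (a n)\<^sup>2 * (c * (LINT \<omega>:B|P. V n \<omega>) + (LINT \<omega>:B|P. D n \<omega>))"
    unfolding integral_\<phi>[OF B] by (intro add_mono mult_left_mono y2) auto
  finally show ?thesis by (simp add: algebra_simps)
qed

text \<open>Dropping the nonnegative drift from the one-step inequality leaves the required
  recursion.\<close>

sublocale almost_supermartingale P "history P x y" V D "\<lambda>n. (a n)\<^sup>2" c d
proof (unfold_locales; (intro subalgebra_hist hist_mono V_adapted V_integrable D_integrable
      D_nonneg D_le c_nonneg)?)
  show "(LINT \<omega>:B|P. V (Suc n) \<omega>)
    \<le> (1 + c * (a n)\<^sup>2) * (LINT \<omega>:B|P. V n \<omega>) + (a n)\<^sup>2 * (LINT \<omega>:B|P. D n \<omega>)"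
    if "B \<in> sets (history P x y n)" for n B
    using one_step[OF that] mult_nonneg_nonneg[OF a_nonneg integral_\<phi>_nonneg, of n B n] by linarith
qed auto

text \<open>Gronwall's inequality on the whole space, with the drift in the role of
  \<open>g\<close>.\<close>

lemma sum_\<phi>_le:
  "(\<Sum>i<k. 2 * a i * expectation (\<phi> i)) \<le> exp (c * (\<Sum>i<k. (a i)\<^sup>2)) *
    ((norm (x0 - z))\<^sup>2 + d * (\<Sum>i<k. (a i)\<^sup>2))"
proof -
  have top: "space P \<in> sets (history P x y n)" for n
    using sets.top[of "history P x y n"] by simp
  have full: "(LINT \<omega>:space P|P. g \<omega>) = expectation g" for g :: "'w \<Rightarrow> real"
    unfolding set_lebesgue_integral_def by (intro Bochner_Integration.integral_cong) auto
  have "expectation (V k) + (\<Sum>i<k. 2 * a i * expectation (\<phi> i)) \<le> exp (\<Sum>i<k. c * (a i)\<^sup>2) *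
    (expectation (V 0) + (\<Sum>i<k. (a i)\<^sup>2 * d))"
  proof (rule discrete_gronwall)
    fix n
    show "expectation (V (Suc n)) + 2 * a n * expectation (\<phi> n) \<le>
        (1 + c * (a n)\<^sup>2) * expectation (V n) + (a n)\<^sup>2 * d"
      using one_step[OF top[of n]] mult_left_mono[OF D_le[of n], of "(a n)\<^sup>2"]
        V_integrable D_integrable
      by (simp add: full)
    show "0 \<le> 2 * a n * expectation (\<phi> n)"
      using a_nonneg[of n] cond_ii[of n] by (intro mult_nonneg_nonneg integral_nonneg_AE) auto
  qed (use c_nonneg d_nonneg in \<open>auto intro!: integral_nonneg_AE\<close>)
  moreover have "0 \<le> expectation (V k)" by simp
  ultimately have "(\<Sum>i<k. 2 * a i * expectation (\<phi> i)) \<le> exp (\<Sum>i<k. c * (a i)\<^sup>2) *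
    (expectation (V 0) + (\<Sum>i<k. (a i)\<^sup>2 * d))" by linarith
  then show ?thesis
    by (simp add: x_0 prob_space sum_distrib_left mult.commute)
qed

end

section \<open>Explicit rates in mean and almost surely\<close>

theorem theorem6p1:
  fixes P :: "'w measure"
    and x0 z :: "'h::{real_inner, banach, second_countable_topology}"
    and x y :: "nat \<Rightarrow> 'w \<Rightarrow> 'h"
    and a :: "nat \<Rightarrow> real"
    and D :: "nat \<Rightarrow> 'w \<Rightarrow> real"
    and L M c d :: real
    and f \<psi> \<kappa> \<tau> :: "real \<Rightarrow> real"
    and \<theta> :: "nat \<Rightarrow> real \<Rightarrow> nat"
    and chi :: "real \<Rightarrow> nat"
  assumes prob: "prob_space P"
    and y_measurable: "\<And>n. y n \<in> borel_measurable P"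
    and a_nonneg: "\<And>n. 0 \<le> a n"
    and x_0: "\<And>\<omega>. x 0 \<omega> = x0"
    and x_Suc: "\<And>n \<omega>. x (Suc n) \<omega> = x n \<omega> - a n *\<^sub>R y n \<omega>"
    and L: "0 < L" "(norm (x0 - z))\<^sup>2 < L"
    and cd: "0 < c" "0 < d"
    and D_measurable: "\<And>n. D n \<in> borel_measurable P"
    and D_nonneg: "\<And>n. AE \<omega> in P. 0 \<le> D n \<omega>"
    and D_bound: "(SUP n. \<integral>\<^sup>+ \<omega>. ennreal (D n \<omega>) \<partial>P) \<le> ennreal d"
    and cond_i: "\<And>n. AE \<omega> in P.
       nn_cond_exp P (history P x y n) (\<lambda>\<omega>. ennreal ((norm (y n \<omega>))\<^sup>2)) \<omega>
         \<le> ennreal (c * (norm (x n \<omega> - z))\<^sup>2 + D n \<omega>)"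
    and cond_ii: "\<And>n. AE \<omega> in P.
       0 \<le> inner (x n \<omega> - z) (cond_exp P (history P x y n) (y n) \<omega>)"
    and sicc: "sicc f \<psi> \<kappa>"
    and \<tau>_pos: "\<And>\<epsilon>. 0 < \<epsilon> \<Longrightarrow> 0 < \<tau> \<epsilon>"
    and cond_iii: "\<And>\<epsilon> n. 0 < \<epsilon> \<Longrightarrow>
       (LINT \<omega>|P. inner (x n \<omega> - z) (cond_exp P (history P x y n) (y n) \<omega>)) < \<tau> \<epsilon> \<Longrightarrow>
       (LINT \<omega>|P. f ((norm (x n \<omega> - z))\<^sup>2)) < \<epsilon>"
    and a_diverges: "filterlim (\<lambda>N. \<Sum>n<N. a n) at_top sequentially"
    and \<theta>: "divergence_rate a \<theta>"
    and a_sq: "summable (\<lambda>n. (a n)\<^sup>2)" "(\<Sum>n. (a n)\<^sup>2) < M"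
    and chi: "series_convergence_rate (\<lambda>n. (a n)\<^sup>2) chi"
  shows "let K1 = 1 / 2 * \<psi> (exp (- c * M));
             K2 = exp (c * M) * (L + d * M);
             \<rho> = (\<lambda>\<epsilon>. \<theta> (chi (\<kappa> (K1 * \<epsilon>) / d)) (K2 / \<tau> (K1 * \<epsilon>)))
         in mean_rate P (\<lambda>n \<omega>. f ((norm (x n \<omega> - z))\<^sup>2)) \<rho> \<and>
            as_rate P x z (\<lambda>\<delta> \<epsilon>. \<rho> (\<delta> * f (\<epsilon>\<^sup>2)))"
proof -
  interpret prob_space P by fact
  interpret stochastic_iteration P x0 z x y a D c d
    using y_measurable a_nonneg x_0 x_Suc cd D_measurable D_nonneg D_bound cond_i cond_ii
    by unfold_locales auto
  define K where "K = c * M"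
  define K1 where "K1 = 1 / 2 * \<psi> (exp (- K))"
  define K2 where "K2 = exp K * (L + d * M)"
  define \<rho> where "\<rho> = (\<lambda>\<epsilon>. \<theta> (chi (\<kappa> (K1 * \<epsilon>) / d)) (K2 / \<tau> (K1 * \<epsilon>)))"
  define h where "h t = f (max 0 t)" for t
  interpret h: concave_gauge h
    unfolding h_def by (rule sicc_imp_concave_gauge[OF sicc])
  have hf: "h t = f t" if "0 \<le> t" for t
    using that by (simp add: h_def)
  have sum_M: "(\<Sum>i<k. (a (n + i))\<^sup>2) \<le> M" for n k
    using sum_shift_le_suminf[OF a_sq(1), of 0 n k] a_sq(2) by simp
  have M: "0 < M"
    using suminf_nonneg[OF a_sq(1)] a_sq(2) by simp
  have K: "0 < K" and K2: "0 < K2"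
    using M cd L by (auto simp: K_def K2_def intro!: mult_pos_pos add_pos_pos)
  have \<psi>: "0 < \<psi> (exp (- K))" and K1: "0 < K1"
    using sicc K by (auto simp: sicc_def supermultiplicative_def K1_def)
  \<comment> \<open>Supermultiplicativity removes the factor \<open>exp (- K)\<close> inside the
    gauge at the cost of the constant \<open>\<psi> (exp (- K))\<close>, which is why
    \<open>\<psi>\<close> enters \<open>K1\<close>.\<close>
  have h_\<psi>: "\<psi> (exp (- K)) * h t \<le> h (exp (- K) * t)" if "0 \<le> t" for t
  proof -
    have "\<forall>s\<ge>0. \<forall>r\<in>{0..1}. f s * \<psi> r \<le> f (s * r)"
      using sicc by (simp add: sicc_def supermultiplicative_def)
    then have "f t * \<psi> (exp (- K)) \<le> f (t * exp (- K))" using that K by auto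
    then show ?thesis using that by (simp add: hf mult.commute)
  qed

  \<comment> \<open>The target is twice \<open>K1 * \<epsilon>\<close>: one half is for the mean of
    \<open>h (V n \<omega>)\<close>, the other for the later noise \<open>h b\<close>.\<close>
  have start: "\<exists>n b. n \<le> \<rho> \<epsilon> \<and> (\<forall>k. d * (\<Sum>i<k. (a (n + i))\<^sup>2) < b) \<and>
      expectation (\<lambda>\<omega>. h (V n \<omega>)) + h b < \<psi> (exp (- K)) * \<epsilon>"
    if \<epsilon>: "0 < \<epsilon>" for \<epsilon>
  proof -
    define T where "T = \<tau> (K1 * \<epsilon>)"
    define q where "q = \<kappa> (K1 * \<epsilon>)"
    define N where "N = chi (q / d)"
    have K1\<epsilon>: "0 < K1 * \<epsilon>" using K1 \<epsilon> by simp
    have T: "0 < T" using \<tau>_pos[OF K1\<epsilon>] by (simp add: T_def)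
    have q: "0 < q" and q_mod: "\<And>t. 0 \<le> t \<Longrightarrow> t < q \<Longrightarrow> f t < K1 * \<epsilon>"
      using sicc K1\<epsilon> by (auto simp: sicc_def modulus_at_0_def q_def)
    define n1 where "n1 = \<theta> N (K2 / T)"
    have n1: "n1 = \<rho> \<epsilon>" by (simp add: n1_def \<rho>_def N_def q_def T_def)
    \<comment> \<open>If the mean drift were at least \<open>T\<close> on the whole window, where
      the steps sum to at least \<open>K2 / T\<close>, its weighted sum would reach
      \<open>K2\<close>. The Gronwall bound is strictly smaller because the initial squared distance
      is below \<open>L\<close>.\<close>
    have "\<exists>n\<in>{N..n1}. expectation (\<phi> n) < T"
    proof (rule ccontr)
      assume "\<not> ?thesis"
      then have ge: "T \<le> expectation (\<phi> n)" if "n \<in> {N..n1}" for n using that by force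
      have \<phi>_nonneg: "0 \<le> expectation (\<phi> n)" for n
        using cond_ii[of n] by (intro integral_nonneg_AE)
      have "K2 / T \<le> (\<Sum>n = N..n1. a n)"
        using \<theta> K2 T by (auto simp: divergence_rate_def n1_def)
      then have "K2 \<le> (\<Sum>n = N..n1. a n) * T" using T by (simp add: field_simps)
      also have "\<dots> = (\<Sum>n = N..n1. a n * T)" by (rule sum_distrib_right)
      also have "\<dots> \<le> (\<Sum>n = N..n1. 2 * a n * expectation (\<phi> n))"
      proof (rule sum_mono)
        fix n assume "n \<in> {N..n1}"
        then have "a n * T \<le> a n * expectation (\<phi> n)" by (intro mult_left_mono ge a_nonneg)
        then show "a n * T \<le> 2 * a n * expectation (\<phi> n)"
          using mult_nonneg_nonneg[OF a_nonneg \<phi>_nonneg, of n n] by simp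
      qed
      also have "\<dots> \<le> (\<Sum>n<Suc n1. 2 * a n * expectation (\<phi> n))"
        using a_nonneg \<phi>_nonneg by (intro sum_mono2) auto
      also have "\<dots> \<le> exp (c * (\<Sum>i<Suc n1. (a i)\<^sup>2)) * ((norm (x0 - z))\<^sup>2 + d * (\<Sum>i<Suc n1. (a i)\<^sup>2))"
        by (rule sum_\<phi>_le)
      also have "\<dots> \<le> exp K * ((norm (x0 - z))\<^sup>2 + d * M)"
      proof -
        have "(\<Sum>i<Suc n1. (a (0 + i))\<^sup>2) \<le> M" by (rule sum_M)
        then show ?thesis
          unfolding K_def using cd
          by (intro mult_mono add_mono order_refl iffD2[OF exp_le_cancel_iff] mult_left_mono)
             (auto intro!: add_nonneg_nonneg mult_nonneg_nonneg sum_nonneg simp del: sum.lessThan_Suc)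
      qed
      also have "\<dots> < K2"
        using L by (simp add: K2_def)
      finally show False by simp
    qed
    then obtain n where n: "N \<le> n" "n \<le> n1" "expectation (\<phi> n) < T" by auto
    have Ef: "expectation (\<lambda>\<omega>. h (V n \<omega>)) < K1 * \<epsilon>"
      using cond_iii[OF K1\<epsilon>, of n] n(3) by (simp add: hf T_def)
    define tail where "tail = (\<Sum>i. (a (i + N))\<^sup>2)"
    have tail: "0 \<le> tail" "d * tail < q"
    proof -
      have "tail < q / d"
        using chi q cd by (auto simp: series_convergence_rate_def tail_def N_def)
      then show "d * tail < q" using cd by (simp add: field_simps)
      show "0 \<le> tail"
        unfolding tail_def by (intro suminf_nonneg summable_ignore_initial_segment[OF a_sq(1)]) simp
    qed
    \<comment> \<open>The midpoint lies strictly above the total noise, as the gauge bounds demand,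
      and strictly below \<open>q\<close>, so that the modulus \<open>\<kappa>\<close> makes
      \<open>h b\<close> smaller than \<open>K1 * \<epsilon>\<close>.\<close>
    define b where "b = (d * tail + q) / 2"
    have "0 \<le> d * tail" using cd tail by simp
    with tail have b: "0 \<le> b" "b < q" "d * tail < b"
      by (auto simp: b_def)
    have "d * (\<Sum>i<k. (a (n + i))\<^sup>2) < b" for k
    proof -
      have "d * (\<Sum>i<k. (a (n + i))\<^sup>2) \<le> d * tail"
        unfolding tail_def using cd sum_shift_le_suminf[OF a_sq(1), of N n k] n(1)
        by (intro mult_left_mono) auto
      also note b(3)
      finally show ?thesis .
    qed
    moreover have "expectation (\<lambda>\<omega>. h (V n \<omega>)) + h b < \<psi> (exp (- K)) * \<epsilon>"
      using Ef q_mod[OF b(1,2)] b(1) by (simp add: hf K1_def)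
    ultimately show ?thesis using n(2) n1 by blast
  qed
  have Ksum: "c * (\<Sum>i<k. (a (n + i))\<^sup>2) \<le> K" for n k
    unfolding K_def using cd by (intro mult_left_mono sum_M) auto

  have "mean_rate P (\<lambda>n \<omega>. f (V n \<omega>)) \<rho>"
    unfolding mean_rate_def
  proof (intro allI impI conjI)
    fix \<epsilon> :: real and m assume \<epsilon>: "0 < \<epsilon>" and m: "\<rho> \<epsilon> \<le> m"
    have int: "integrable P (\<lambda>\<omega>. h (t * V m \<omega>))" if "0 \<le> t" for t
      using that V_integrable by (intro h.integrable_gauge finite_measure_axioms) auto
    show "integrable P (\<lambda>\<omega>. f (V m \<omega>))"
      using int[of 1] by (simp add: hf)
    obtain n b where n: "n \<le> \<rho> \<epsilon>" and b: "\<And>k. d * (\<Sum>i<k. (a (n + i))\<^sup>2) < b"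
      and lt: "expectation (\<lambda>\<omega>. h (V n \<omega>)) + h b < \<psi> (exp (- K)) * \<epsilon>"
      using start[OF \<epsilon>] by blast
    \<comment> \<open>The good index \<open>n\<close> depends on the unknown drift, but it precedes
      the rate, so every \<open>m\<close> beyond the rate is reached from it.\<close>
    obtain k where k: "m = n + k" using n m le_Suc_ex order_trans by metis
    have "\<psi> (exp (- K)) * expectation (\<lambda>\<omega>. h (V m \<omega>)) = expectation (\<lambda>\<omega>. \<psi> (exp (- K)) * h (V m \<omega>))"
      by simp
    also have "\<dots> \<le> expectation (\<lambda>\<omega>. h (exp (- K) * V m \<omega>))"
      using int[of 1] int[of "exp (- K)"] by (intro integral_mono h_\<psi>) auto
    also have "\<dots> \<le> expectation (\<lambda>\<omega>. h (V n \<omega>)) + h b"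
      unfolding k by (rule gauge_V_bound[OF h.concave_gauge_axioms Ksum b])
    also note lt
    finally show "expectation (\<lambda>\<omega>. f (V m \<omega>)) < \<epsilon>"
      using \<psi> by (simp add: hf)
  qed
  moreover have "as_rate P x z (\<lambda>\<delta> \<epsilon>. \<rho> (\<delta> * f (\<epsilon>\<^sup>2)))"
    unfolding as_rate_def
  proof (intro allI impI)
    fix \<delta> \<epsilon> :: real assume \<delta>: "0 < \<delta>" and \<epsilon>: "0 < \<epsilon>"
    let ?N = "\<rho> (\<delta> * f (\<epsilon>\<^sup>2))"
    have f\<epsilon>: "0 < f (\<epsilon>\<^sup>2)"
    proof -
      have "strict_mono_on {0..} f" "f 0 = 0" using sicc by (auto simp: sicc_def)
      then show ?thesis using strict_mono_onD[of "{0..}" f 0 "\<epsilon>\<^sup>2"] \<epsilon> by simp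
    qed
    \<comment> \<open>The level carries the factor \<open>f (\<epsilon>\<^sup>2)\<close> because the
      maximal inequality bounds the probability times a multiple of it; cancelling leaves
      \<open>\<delta>\<close>.\<close>
    with \<delta> have "0 < \<delta> * f (\<epsilon>\<^sup>2)" by simp
    then obtain n b where n: "n \<le> ?N" and b: "\<And>k. d * (\<Sum>i<k. (a (n + i))\<^sup>2) < b"
      and lt: "expectation (\<lambda>\<omega>. h (V n \<omega>)) + h b < \<psi> (exp (- K)) * (\<delta> * f (\<epsilon>\<^sup>2))"
      using start by blast
    let ?A = "{\<omega> \<in> space P. \<exists>m\<ge>n. \<epsilon>\<^sup>2 \<le> V m \<omega>}"
    have "prob {\<omega> \<in> space P. \<exists>n\<ge>?N. \<epsilon> \<le> norm (x n \<omega> - z)} \<le> prob ?A"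
    proof (rule finite_measure_mono)
      show "{\<omega> \<in> space P. \<exists>n\<ge>?N. \<epsilon> \<le> norm (x n \<omega> - z)} \<subseteq> ?A"
        using n \<epsilon> by (auto intro: power_mono order_trans)
      show "?A \<in> sets P" by measurable
    qed
    moreover have "prob ?A * (\<psi> (exp (- K)) * f (\<epsilon>\<^sup>2)) \<le> prob ?A * h (exp (- K) * \<epsilon>\<^sup>2)"
      using h_\<psi>[of "\<epsilon>\<^sup>2"] by (intro mult_left_mono) (auto simp: hf)
    moreover have "\<dots> \<le> expectation (\<lambda>\<omega>. h (V n \<omega>)) + h b"
      by (rule gauge_maximal_inequality[OF h.concave_gauge_axioms Ksum b]) simp
    ultimately have "prob ?A * (\<psi> (exp (- K)) * f (\<epsilon>\<^sup>2)) < \<delta> * (\<psi> (exp (- K)) * f (\<epsilon>\<^sup>2))"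
      using lt by (simp add: mult_ac)
    then have "prob ?A < \<delta>"
      using \<psi> f\<epsilon> by (simp add: mult_less_cancel_right_pos)
    with \<open>prob _ \<le> prob ?A\<close>
    show "prob {\<omega> \<in> space P. \<exists>n\<ge>?N. \<epsilon> \<le> norm (x n \<omega> - z)} < \<delta>"
      by simp
  qed
  ultimately show ?thesis
    by (simp add: Let_def \<rho>_def K1_def K2_def K_def)
qed

end
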